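(* Suppose that $z \in \rho(A)$ and \begin{itemize} \item $z \notin \mathcal{S}$; \item the characteristic polynomial $\mathcal{P}$ (with $\lambda$ replaced by $z$) has $2N$ distinct roots, denoted $\pm\rho_i(z)$, $i=1,\ldots,N$; \item $k_j(z) \neq \pm \rho_i(z)$ for all $i,j = 1,\ldots,N$; and \item the $2N\times 2N$ matrix $T(z)$ is invertible. \end{itemize} Then the solution $\psi$ of the resolvent equation $(z - A)\psi = \phi$ (for given $\phi \in X$) is given by $\psi_z = \varepsilon_z \otimes q_z + H_z\phi$, where \[ q_z(x) = \frac{h_z(x)}{z+\alpha} + \sum_{i=1}^{N}\bigl[\gamma_{i,z}(x)e^{\rho_i(z)x} + \gamma_{-i,z}(x)e^{-\rho_i(z)x}\bigr] \qquad \forall\, x \in [-1,1], \] with $\Gamma_z = [\gamma_{1,z},\ldots,\gamma_{N,z},\gamma_{-1,z},\ldots,\gamma_{-N,z}]$ given by \[ \Gamma_z(x) = \Gamma_{0,z} + \hat\Gamma_z(x), \qquad \hat\Gamma_z(x) = \int_{x_0}^{x} \frac{h_z(r)}{z+\alpha}\begin{bmatrix} P^-_z(r) & 0 \\ 0 & P^+_z(r)\end{bmatrix} T(z)^{-1}\begin{bmatrix} -\mathbf{1} \\ \mathbf{1}\end{bmatrix} dr, \] for a reference point $x_0 \in [-1,1]$, and \[ \Gamma_{0,z} = -S(z)^{-1}\begin{bmatrix} S^-_z & S^+_z & 0 & 0\\ 0 & 0 & S^+_z & S^-_z\end{bmatrix}\begin{bmatrix}\hat\Gamma_z(1)\\ \hat\Gamma_z(-1)\end{bmatrix},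 \] and where \[ h_z(x) = \phi(0,x) + \int_{-1}^{1}\int_{-\tau_0-|x-r|}^{0} J(x,r)\,e^{-z(\tau_0+s)-z|x-r|}\,\phi(s,r)\,ds\,dr \qquad \forall\,x\in[-1,1]. \]
   Context: Setting: $Y = C([-1,1])$ (complex-valued continuous functions, sup norm), $\tau_0 \ge 0$, $h = \tau_0 + 2$, $X = C([-h,0];Y)$, $\alpha > 0$. Delay $\tau(x,r) = \tau_0 + |x-r|$ and connectivity $J(x,r) = \sum_{i=1}^N c_i e^{-\mu_i|x-r|}$ with $c_i \in \mathbb{C}\setminus\{0\}$ and pairwise distinct $\mu_i \in \mathbb{C}$. Let $L \in \mathcal{L}(X,Y)$, $(L\phi)(x) = \int_{-1}^1 J(x,r)\phi(-\tau_0-|x-r|,r)\,dr$, and let $A$ be the generator of the solution semigroup of $\dot V(t) = -\alpha V(t) + L V_t$: $D(A) = \{\phi \in X : \phi' \in X,\ \phi'(0) = -\alpha\phi(0) + L\phi\}$, $A\phi = \phi'$; $\rho(A)$ is its resolvent set. For $z\in\mathbb{C}$: $\varepsilon_z(\theta) = e^{z\theta}$, $(\varepsilon_z\otimes q)(\theta) = e^{z\theta}q$ for $q\in Y$, and $(H_z\phi)(\theta) = \int_\theta^0 e^{z(\theta-s)}\phi(s)\,ds$, $\theta\in[-h,0]$. Let $k_i(z) = z + \mu_i$ and $\mathcal{S} = \{z \in \mathbb{C} : k_i(z)^2 = k_j(z)^2 \text{ for some } i \neq j\}$. The characteristic polynomial is $\mathcal{P}(\rho) = \tfrac{1}{2}e^{z\tau_0}(z+\alpha)\prod_{j=1}^N(\rho^2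 - k_j(z)^2) + \sum_{i=1}^N c_i k_i(z)\prod_{j\ne i}(\rho^2 - k_j(z)^2)$. With roots $\pm\rho_i(z)$: $T(z) = \begin{bmatrix} T^-_z & T^+_z\\ T^+_z & T^-_z\end{bmatrix}$, $[T^\pm_z]_{j,i} = 1/(k_j(z) \pm \rho_i(z))$; $P^\pm_z(x) = \mathrm{diag}(e^{\pm\rho_1(z)x},\ldots,e^{\pm\rho_N(z)x})$; $\mathbf{1}\in\mathbb{R}^N$ is the all-ones vector; $S(z) = \begin{bmatrix} S^-_z & S^+_z\\ S^+_z & S^-_z\end{bmatrix}$ with $[S^-_z]_{j,i} = e^{\rho_i(z)}/(z+\mu_j-\rho_i(z))$, $[S^+_z]_{j,i} = e^{-\rho_i(z)}/(z+\mu_j+\rho_i(z))$. *)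

theory Defs
  imports "HOL-Analysis.Analysis" "Jordan_Normal_Form.Matrix"
begin

text \<open>Phase space. An element of X = C([-h,0];Y), Y = C([-1,1]) (complex valued, sup norm)
  is represented as a function phi s x (s the delay variable, x the space variable) that is
  jointly continuous on the rectangle [-h,0] x [-1,1] and, for uniqueness of representatives,
  equal to 0 outside of it.\<close>

definition rect :: "real \<Rightarrow> (real \<times> real) set" where
  "rect h = {-h..0} \<times> {-1..1}"

definition Xsp :: "real \<Rightarrow> (real \<Rightarrow> real \<Rightarrow> complex) set" where
  "Xsp h = {\<phi>. continuous_on (rect h) (\<lambda>(s,x). \<phi> s x) \<and>
                (\<forall>s x. (s,x) \<notin> rect h \<longrightarrow> \<phi> s x = 0)}"

definition Xnorm :: "real \<Rightarrow> (real \<Rightarrow> real \<Rightarrow> complex) \<Rightarrow> real" where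
  "Xnorm h \<phi> = Sup ((\<lambda>(s,x). norm (\<phi> s x)) ` rect h)"

text \<open>phi' is the derivative of phi as a map [-h,0] -> Y, Y with the sup norm
  (one-sided at the endpoints).\<close>
definition X_deriv :: "real \<Rightarrow> (real \<Rightarrow> real \<Rightarrow> complex) \<Rightarrow> (real \<Rightarrow> real \<Rightarrow> complex) \<Rightarrow> bool" where
  "X_deriv h \<phi> \<phi>' \<longleftrightarrow> (\<forall>s\<in>{-h..0}.
     uniform_limit {-1..1} (\<lambda>t x. (\<phi> (s + t) x - \<phi> s x) / complex_of_real t) (\<phi>' s)
        (at 0 within {t. s + t \<in> {-h..0}}))"

definition Jfun :: "nat \<Rightarrow> (nat \<Rightarrow> complex) \<Rightarrow> (nat \<Rightarrow> complex) \<Rightarrow> real \<Rightarrow> real \<Rightarrow> complex" where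
  "Jfun N c \<mu> x r = (\<Sum>i<N. c i * exp (- \<mu> i * complex_of_real \<bar>x - r\<bar>))"

definition Lop :: "real \<Rightarrow> nat \<Rightarrow> (nat \<Rightarrow> complex) \<Rightarrow> (nat \<Rightarrow> complex)
                    \<Rightarrow> (real \<Rightarrow> real \<Rightarrow> complex) \<Rightarrow> real \<Rightarrow> complex" where
  "Lop \<tau>0 N c \<mu> \<phi> x = integral {-1..1} (\<lambda>r. Jfun N c \<mu> x r * \<phi> (- \<tau>0 - \<bar>x - r\<bar>) r)"

text \<open>Graph of the generator A: genA ... phi psi  iff  phi in D(A) and A phi = psi,
  with h = tau0 + 2.\<close>
definition genA :: "real \<Rightarrow> real \<Rightarrow> nat \<Rightarrow> (nat \<Rightarrow> complex) \<Rightarrow> (nat \<Rightarrow> complex)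
                    \<Rightarrow> (real \<Rightarrow> real \<Rightarrow> complex) \<Rightarrow> (real \<Rightarrow> real \<Rightarrow> complex) \<Rightarrow> bool" where
  "genA \<tau>0 \<alpha> N c \<mu> \<phi> \<psi> \<longleftrightarrow>
     \<phi> \<in> Xsp (\<tau>0 + 2) \<and> \<psi> \<in> Xsp (\<tau>0 + 2) \<and> X_deriv (\<tau>0 + 2) \<phi> \<psi> \<and>
     (\<forall>x\<in>{-1..1}. \<psi> 0 x = - complex_of_real \<alpha> * \<phi> 0 x + Lop \<tau>0 N c \<mu> \<phi> x)"

definition resolvent_set :: "real \<Rightarrow> real \<Rightarrow> nat \<Rightarrow> (nat \<Rightarrow> complex) \<Rightarrow> (nat \<Rightarrow> complex) \<Rightarrow> complex set" where
  "resolvent_set \<tau>0 \<alpha> N c \<mu> = {z.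
     (\<forall>\<phi>\<in>Xsp (\<tau>0 + 2). \<exists>!\<psi>. \<exists>A\<psi>. genA \<tau>0 \<alpha> N c \<mu> \<psi> A\<psi> \<and> (\<lambda>s x. z * \<psi> s x - A\<psi> s x) = \<phi>) \<and>
     (\<exists>C. \<forall>\<psi> A\<psi>. genA \<tau>0 \<alpha> N c \<mu> \<psi> A\<psi> \<longrightarrow>
            Xnorm (\<tau>0 + 2) \<psi> \<le> C * Xnorm (\<tau>0 + 2) (\<lambda>s x. z * \<psi> s x - A\<psi> s x))}"

definition kf :: "(nat \<Rightarrow> complex) \<Rightarrow> complex \<Rightarrow> nat \<Rightarrow> complex" where
  "kf \<mu> z i = z + \<mu> i"

definition Sset :: "nat \<Rightarrow> (nat \<Rightarrow> complex) \<Rightarrow> complex set" where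
  "Sset N \<mu> = {z. \<exists>i<N. \<exists>j<N. i \<noteq> j \<and> (kf \<mu> z i)\<^sup>2 = (kf \<mu> z j)\<^sup>2}"

definition charP :: "real \<Rightarrow> real \<Rightarrow> nat \<Rightarrow> (nat \<Rightarrow> complex) \<Rightarrow> (nat \<Rightarrow> complex)
                     \<Rightarrow> complex \<Rightarrow> complex \<Rightarrow> complex" where
  "charP \<tau>0 \<alpha> N c \<mu> z \<rho> =
     1/2 * exp (z * complex_of_real \<tau>0) * (z + complex_of_real \<alpha>) * (\<Prod>j<N. \<rho>\<^sup>2 - (kf \<mu> z j)\<^sup>2)
     + (\<Sum>i<N. c i * kf \<mu> z i * (\<Prod>j\<in>{..<N} - {i}. \<rho>\<^sup>2 - (kf \<mu> z j)\<^sup>2))"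

text \<open>Matrix inverse (meaningful for invertible square matrices).\<close>
definition minv :: "complex mat \<Rightarrow> complex mat" where
  "minv A = (SOME B. inverts_mat A B \<and> inverts_mat B A)"

definition Tmat :: "nat \<Rightarrow> (nat \<Rightarrow> complex) \<Rightarrow> (nat \<Rightarrow> complex) \<Rightarrow> complex \<Rightarrow> complex mat" where
  "Tmat N \<mu> \<rho> z =
     (let Tm = mat N N (\<lambda>(j,i). 1 / (kf \<mu> z j - \<rho> i));
          Tp = mat N N (\<lambda>(j,i). 1 / (kf \<mu> z j + \<rho> i))
      in four_block_mat Tm Tp Tp Tm)"

definition Sminus :: "nat \<Rightarrow> (nat \<Rightarrow> complex) \<Rightarrow> (nat \<Rightarrow> complex) \<Rightarrow> complex \<Rightarrow> complex mat" where
  "Sminus N \<mu> \<rho> z = mat N N (\<lambda>(j,i). exp (\<rho> i) / (z + \<mu> j - \<rho> i))"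

definition Splus :: "nat \<Rightarrow> (nat \<Rightarrow> complex) \<Rightarrow> (nat \<Rightarrow> complex) \<Rightarrow> complex \<Rightarrow> complex mat" where
  "Splus N \<mu> \<rho> z = mat N N (\<lambda>(j,i). exp (- \<rho> i) / (z + \<mu> j + \<rho> i))"

definition Smat :: "nat \<Rightarrow> (nat \<Rightarrow> complex) \<Rightarrow> (nat \<Rightarrow> complex) \<Rightarrow> complex \<Rightarrow> complex mat" where
  "Smat N \<mu> \<rho> z = four_block_mat (Sminus N \<mu> \<rho> z) (Splus N \<mu> \<rho> z) (Splus N \<mu> \<rho> z) (Sminus N \<mu> \<rho> z)"

text \<open>The 2N x 4N matrix [S^- S^+ 0 0; 0 0 S^+ S^-].\<close>
definition Smid :: "nat \<Rightarrow> (nat \<Rightarrow> complex) \<Rightarrow> (nat \<Rightarrow> complex) \<Rightarrow> complex \<Rightarrow> complex mat" where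
  "Smid N \<mu> \<rho> z = four_block_mat
      (four_block_mat (Sminus N \<mu> \<rho> z) (Splus N \<mu> \<rho> z) (0\<^sub>m 0 N) (0\<^sub>m 0 N))
      (0\<^sub>m N (2*N)) (0\<^sub>m N (2*N))
      (four_block_mat (Splus N \<mu> \<rho> z) (Sminus N \<mu> \<rho> z) (0\<^sub>m 0 N) (0\<^sub>m 0 N))"

definition Pminus :: "nat \<Rightarrow> (nat \<Rightarrow> complex) \<Rightarrow> real \<Rightarrow> complex mat" where
  "Pminus N \<rho> x = mat_diag N (\<lambda>i. exp (- \<rho> i * complex_of_real x))"

definition Pplus :: "nat \<Rightarrow> (nat \<Rightarrow> complex) \<Rightarrow> real \<Rightarrow> complex mat" where
  "Pplus N \<rho> x = mat_diag N (\<lambda>i. exp (\<rho> i * complex_of_real x))"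

definition Pblock :: "nat \<Rightarrow> (nat \<Rightarrow> complex) \<Rightarrow> real \<Rightarrow> complex mat" where
  "Pblock N \<rho> x = four_block_mat (Pminus N \<rho> x) (0\<^sub>m N N) (0\<^sub>m N N) (Pplus N \<rho> x)"

definition mones :: "nat \<Rightarrow> complex vec" where
  "mones N = vec N (\<lambda>_. -1) @\<^sub>v vec N (\<lambda>_. 1)"

definition oint :: "real \<Rightarrow> real \<Rightarrow> (real \<Rightarrow> complex) \<Rightarrow> complex" where
  "oint a b f = (if a \<le> b then integral {a..b} f else - integral {b..a} f)"

definition hz :: "real \<Rightarrow> nat \<Rightarrow> (nat \<Rightarrow> complex) \<Rightarrow> (nat \<Rightarrow> complex) \<Rightarrow> complex
                  \<Rightarrow> (real \<Rightarrow> real \<Rightarrow> complex) \<Rightarrow> real \<Rightarrow> complex" where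
  "hz \<tau>0 N c \<mu> z \<phi> x = \<phi> 0 x +
     integral {-1..1} (\<lambda>r. integral {- \<tau>0 - \<bar>x - r\<bar>..0} (\<lambda>s.
        Jfun N c \<mu> x r * exp (- z * complex_of_real (\<tau>0 + s) - z * complex_of_real \<bar>x - r\<bar>) * \<phi> s r))"

definition Gammahat :: "real \<Rightarrow> real \<Rightarrow> nat \<Rightarrow> (nat \<Rightarrow> complex) \<Rightarrow> (nat \<Rightarrow> complex) \<Rightarrow> (nat \<Rightarrow> complex)
                        \<Rightarrow> complex \<Rightarrow> (real \<Rightarrow> real \<Rightarrow> complex) \<Rightarrow> real \<Rightarrow> real \<Rightarrow> complex vec" where
  "Gammahat \<tau>0 \<alpha> N c \<mu> \<rho> z \<phi> x0 x = vec (2*N) (\<lambda>k. oint x0 x (\<lambda>r.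
      (hz \<tau>0 N c \<mu> z \<phi> r / (z + complex_of_real \<alpha>)) *
      ((Pblock N \<rho> r *\<^sub>v (minv (Tmat N \<mu> \<rho> z) *\<^sub>v mones N)) $ k)))"

definition Gamma0 :: "real \<Rightarrow> real \<Rightarrow> nat \<Rightarrow> (nat \<Rightarrow> complex) \<Rightarrow> (nat \<Rightarrow> complex) \<Rightarrow> (nat \<Rightarrow> complex)
                        \<Rightarrow> complex \<Rightarrow> (real \<Rightarrow> real \<Rightarrow> complex) \<Rightarrow> real \<Rightarrow> complex vec" where
  "Gamma0 \<tau>0 \<alpha> N c \<mu> \<rho> z \<phi> x0 =
     - (minv (Smat N \<mu> \<rho> z) *\<^sub>v (Smid N \<mu> \<rho> z *\<^sub>v
          (Gammahat \<tau>0 \<alpha> N c \<mu> \<rho> z \<phi> x0 1 @\<^sub>v Gammahat \<tau>0 \<alpha> N c \<mu> \<rho> z \<phi> x0 (-1))))"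

text \<open>Gamma_z(x) = [gamma_1..gamma_N, gamma_{-1}..gamma_{-N}] (0-based: k and N+k).\<close>
definition Gammaz :: "real \<Rightarrow> real \<Rightarrow> nat \<Rightarrow> (nat \<Rightarrow> complex) \<Rightarrow> (nat \<Rightarrow> complex) \<Rightarrow> (nat \<Rightarrow> complex)
                        \<Rightarrow> complex \<Rightarrow> (real \<Rightarrow> real \<Rightarrow> complex) \<Rightarrow> real \<Rightarrow> real \<Rightarrow> complex vec" where
  "Gammaz \<tau>0 \<alpha> N c \<mu> \<rho> z \<phi> x0 x =
     Gamma0 \<tau>0 \<alpha> N c \<mu> \<rho> z \<phi> x0 + Gammahat \<tau>0 \<alpha> N c \<mu> \<rho> z \<phi> x0 x"

definition qz :: "real \<Rightarrow> real \<Rightarrow> nat \<Rightarrow> (nat \<Rightarrow> complex) \<Rightarrow> (nat \<Rightarrow> complex) \<Rightarrow> (nat \<Rightarrow> complex)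
                  \<Rightarrow> complex \<Rightarrow> (real \<Rightarrow> real \<Rightarrow> complex) \<Rightarrow> real \<Rightarrow> real \<Rightarrow> complex" where
  "qz \<tau>0 \<alpha> N c \<mu> \<rho> z \<phi> x0 x =
     hz \<tau>0 N c \<mu> z \<phi> x / (z + complex_of_real \<alpha>) +
     (\<Sum>i<N. (Gammaz \<tau>0 \<alpha> N c \<mu> \<rho> z \<phi> x0 x) $ i * exp (\<rho> i * complex_of_real x)
           + (Gammaz \<tau>0 \<alpha> N c \<mu> \<rho> z \<phi> x0 x) $ (N + i) * exp (- \<rho> i * complex_of_real x))"

definition Hz :: "complex \<Rightarrow> (real \<Rightarrow> real \<Rightarrow> complex) \<Rightarrow> real \<Rightarrow> real \<Rightarrow> complex" where
  "Hz z \<phi> \<theta> x = integral {\<theta>..0} (\<lambda>s. exp (z * complex_of_real (\<theta> - s)) * \<phi> s x)"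

end

theory Submission
  imports Defs "Jordan_Normal_Form.Determinant"
begin

text \<open>Evaluated at 0, the resolvent equation becomes an integral equation for q on [-1,1] with kernel
  a sum of exponentials in |x - r|, and every continuous solution of it yields a solution of the
  resolvent equation; as z lies in the resolvent set, there is only one. It therefore suffices to
  check that the given q solves the integral equation. Its terms E satisfy E' = R E + v g with
  g = h / (z + alpha), where T(z) v = (-1, 1). Integrating against exp (- k_j |x - r|) yields boundary
  terms, which vanish by the choice of the constant vector, and a remainder that collapses because
  the R are roots of the characteristic polynomial. A kernel vector of S(z) would produce a solution
  of the homogeneous equation in the same way, hence a vanishing combination of distinct exponentials,
  so S(z) is invertible.\<close>

subsection \<open>Linear independence of exponentials\<close>

text \<open>Induction on the index set: dividing by one exponential makes its term constant, and
  differentiating removes it. The remaining exponents \<open>d k\<close> are distinct and nonzero,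
  so the induction hypothesis for \<open>a k * d k\<close> makes every other coefficient vanish, and
  then the constant as well.\<close>

lemma exp_sum_eq_zero_imp_coeff_zero:
  fixes w a :: "'k \<Rightarrow> complex"
  assumes "finite K" "inj_on w K" "u < v"
    and "\<forall>x\<in>{u<..<v}. (\<Sum>k\<in>K. a k * exp (w k * complex_of_real x)) = 0"
  shows "\<forall>k\<in>K. a k = 0"
  using assms(1,2,4)
proof (induction K arbitrary: a w rule: finite_induct)
  case empty
  then show ?case by simp
next
  case (insert m K)
  define d where "d k = w k - w m" for k
  have sum0: "a m + (\<Sum>k\<in>K. a k * exp (d k * complex_of_real x)) = 0" if "x \<in> {u<..<v}" for x
  proof -
    have "0 = exp (- w m * complex_of_real x) * (\<Sum>k\<in>insert m K. a k * exp (w k * complex_of_real x))"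
      using insert.prems that by simp
    also have "\<dots> = a m + (\<Sum>k\<in>K. a k * exp (d k * complex_of_real x))"
      using insert.hyps
      by (simp add: algebra_simps sum_distrib_left d_def exp_diff exp_minus divide_simps)
    finally show ?thesis by simp
  qed
  have "(\<Sum>k\<in>K. a k * d k * exp (d k * complex_of_real x)) = 0" if x: "x \<in> {u<..<v}" for x
  proof -
    have "((\<lambda>x. a m + (\<Sum>k\<in>K. a k * exp (d k * complex_of_real x))) has_vector_derivative
        (\<Sum>k\<in>K. a k * d k * exp (d k * complex_of_real x))) (at x)"
      by (rule has_vector_derivative_real_field)
        (auto intro!: derivative_eq_intros sum.cong)
    moreover have "((\<lambda>x. a m + (\<Sum>k\<in>K. a k * exp (d k * complex_of_real x)))
        has_vector_derivative 0) (at x)"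
      by (rule has_vector_derivative_transform_within_open[OF _ open_greaterThanLessThan x])
        (use sum0 in \<open>auto intro: derivative_eq_intros\<close>)
    ultimately show ?thesis
      using vector_derivative_unique_at by blast
  qed
  moreover have "inj_on d K"
    using insert.prems(1) by (auto simp: inj_on_def d_def)
  ultimately have "\<forall>k\<in>K. a k * d k = 0"
    using insert.IH[of d "\<lambda>k. a k * d k"] by blast
  moreover have "d k \<noteq> 0" if "k \<in> K" for k
    using insert.prems(1) insert.hyps(2) that by (auto simp: inj_on_def d_def)
  ultimately have K0: "\<forall>k\<in>K. a k = 0"
    by (metis mult_eq_0_iff)
  have "a m = 0"
    using sum0[of "(u + v) / 2"] K0 \<open>u < v\<close> by auto
  with K0 show ?case by simp
qed

subsection \<open>From the integral equation to the resolvent equation\<close>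

text \<open>\<open>X_deriv\<close> asks for difference quotients that converge uniformly in x. Joint
  continuity on the compact rectangle makes \<open>\<psi>'\<close> uniformly continuous, and the
  mean value inequality bounds the error of the quotient by the oscillation of
  \<open>\<psi>'\<close> between s and s + t, with a bound that does not depend on x.\<close>

lemma X_derivI:
  assumes cont: "continuous_on (rect h) (\<lambda>(s,x). \<psi>' s x)"
    and deriv: "\<And>s x. s \<in> {-h..0} \<Longrightarrow> x \<in> {-1..1} \<Longrightarrow>
      ((\<lambda>s. \<psi> s x) has_vector_derivative \<psi>' s x) (at s within {-h..0})"
  shows "X_deriv h \<psi> \<psi>'"
  unfolding X_deriv_def
proof (intro ballI uniform_limitI)
  fix s e :: real
  assume s: "s \<in> {-h..0}" and e: "0 < e"
  have "uniformly_continuous_on (rect h) (\<lambda>(s,x). \<psi>' s x)"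
    by (rule compact_uniformly_continuous[OF cont]) (auto simp: rect_def intro: compact_Times)
  then obtain d where d: "d > 0" "\<And>p q. p \<in> rect h \<Longrightarrow> q \<in> rect h \<Longrightarrow> dist p q < d \<Longrightarrow>
      dist ((\<lambda>(s,x). \<psi>' s x) p) ((\<lambda>(s,x). \<psi>' s x) q) < e / 2"
    unfolding uniformly_continuous_on_def using half_gt_zero[OF e] by (metis (no_types))
  have close: "norm ((\<psi> (s + t) x - \<psi> s x) / complex_of_real t - \<psi>' s x) < e"
    if t: "t \<noteq> 0" "\<bar>t\<bar> < d" "s + t \<in> {-h..0}" and x: "x \<in> {-1..1}" for t x
  proof -
    have seg: "closed_segment s (s + t) \<subseteq> {-h..0}"
      using s t(3) by (auto simp: closed_segment_eq_real_ivl split: if_splits)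
    have "norm (\<psi> (s + t) x - \<psi> s x - (s + t - s) *\<^sub>R \<psi>' s x) \<le> norm (s + t - s) * (e / 2)"
    proof (rule vector_differentiable_bound_linearization[where S = "closed_segment s (s + t)"
          and f = "\<lambda>s. \<psi> s x" and f' = "\<lambda>s. \<psi>' s x"])
      fix y assume y: "y \<in> closed_segment s (s + t)"
      show "((\<lambda>s. \<psi> s x) has_vector_derivative \<psi>' y x) (at y within closed_segment s (s + t))"
        using deriv[of y x] seg y x has_vector_derivative_within_subset by blast
      have "\<bar>y - s\<bar> \<le> \<bar>t\<bar>"
        using y by (auto simp: closed_segment_eq_real_ivl split: if_splits)
      then have "dist (y, x) (s, x) < d"
        using t(2) by (simp add: dist_prod_def dist_real_def)
      then show "norm (\<psi>' y x - \<psi>' s x) \<le> e / 2"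
        using d(2)[of "(y,x)" "(s,x)"] seg y x s by (auto simp: rect_def dist_norm)
    qed auto
    then have "norm (\<psi> (s + t) x - \<psi> s x - complex_of_real t * \<psi>' s x) \<le> \<bar>t\<bar> * (e / 2)"
      by (simp add: scaleR_conv_of_real)
    moreover have "(\<psi> (s + t) x - \<psi> s x) / complex_of_real t - \<psi>' s x =
        (\<psi> (s + t) x - \<psi> s x - complex_of_real t * \<psi>' s x) / complex_of_real t"
      using t(1) by (simp add: field_simps)
    ultimately have "norm ((\<psi> (s + t) x - \<psi> s x) / complex_of_real t - \<psi>' s x) \<le> e / 2"
      using t(1) by (simp add: norm_divide field_simps)
    then show ?thesis using e by simp
  qed
  show "\<forall>\<^sub>F t in at 0 within {t. s + t \<in> {-h..0}}. \<forall>x\<in>{-1..1}.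
      dist ((\<psi> (s + t) x - \<psi> s x) / complex_of_real t) (\<psi>' s x) < e"
    unfolding eventually_at using d(1) close
    by (intro exI[of _ d]) (auto simp: dist_norm)
qed

section \<open>The particular solution \<open>Hz\<close> and its regularity\<close>

lemma Hz_eq: "Hz z \<phi> \<theta> x =
  exp (z * complex_of_real \<theta>) * integral {\<theta>..0} (\<lambda>s. exp (- z * complex_of_real s) * \<phi> s x)"
  unfolding Hz_def integral_mult_right[symmetric]
  by (intro integral_cong) (simp add: exp_diff exp_minus right_diff_distrib field_simps)

lemma continuous_on_integral_to_zero:
  fixes f :: "real \<Rightarrow> real \<Rightarrow> complex"
  assumes "continuous_on (rect h) (\<lambda>(s,x). f s x)"
  shows "continuous_on (rect h) (\<lambda>(\<theta>,x). integral {\<theta>..0} (\<lambda>s. f s x))"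
proof -
  \<comment> \<open>Continuity of parametric integrals is available on a fixed interval only, so rescale to [0,1].\<close>
  have eq: "integral {\<theta>..0} (\<lambda>s. f s x) = - \<theta> *\<^sub>R integral (cbox 0 1) (\<lambda>u. f (\<theta> * u) x)"
    if \<theta>: "(\<theta>, x) \<in> rect h" for \<theta> x
  proof (cases "\<theta> = 0")
    case False
    then have neg: "\<theta> < 0" using \<theta> by (simp add: rect_def)
    have "continuous_on {\<theta>..0} (\<lambda>s. f s x)"
      by (rule continuous_on_compose2[OF assms, where f = "\<lambda>s. (s, x)", simplified])
        (use \<theta> in \<open>auto simp: rect_def intro!: continuous_intros\<close>)
    then have "((\<lambda>s. f s x) has_integral integral {\<theta>..0} (\<lambda>s. f s x)) (cbox \<theta> 0)"
      by (metis integrable_continuous_real integrable_integral box_real(2))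
    \<comment> \<open>Division by the negative \<theta> reverses the order and sends \<theta> to 1.
      The affine substitution rule contributes the factor |\<theta>| = -\<theta>, which is the sign
      in \<open>eq\<close>.\<close>
    moreover have img: "(\<lambda>x. x / \<theta>) ` {\<theta>..0} = {0..1}"
    proof -
      have "u \<in> (\<lambda>x. x / \<theta>) ` {\<theta>..0}" if "u \<in> {0..1}" for u
        using that neg mult_nonpos_nonneg[of \<theta> u] mult_left_mono_neg[of u 1 \<theta>]
        by (intro image_eqI[of _ _ "\<theta> * u"]) simp_all
      then show ?thesis using neg by (auto simp: divide_simps)
    qed
    ultimately
    have "((\<lambda>u. f (\<theta> * u) x) has_integral (1 / \<bar>\<theta>\<bar>) *\<^sub>R integral {\<theta>..0} (\<lambda>s. f s x))
        ((\<lambda>x. x / \<theta>) ` {\<theta>..0})"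
      using has_integral_affinity[of "\<lambda>s. f s x" _ \<theta> 0 \<theta> 0] neg by simp
    then
    have "((\<lambda>u. f (\<theta> * u) x) has_integral (1 / \<bar>\<theta>\<bar>) *\<^sub>R integral {\<theta>..0} (\<lambda>s. f s x))
        (cbox 0 1)"
      using neg by (simp add: img)
    then show ?thesis
      using neg by (simp add: integral_unique)
  qed simp
  have "continuous_on (rect h) (\<lambda>p. - fst p *\<^sub>R integral (cbox 0 1) (\<lambda>u. f (fst p * u) (snd p)))"
  proof (intro continuous_intros integral_continuous_on_param)
    show "continuous_on (rect h \<times> cbox 0 1) (\<lambda>(p, u). f (fst p * u) (snd p))"
    proof -
      have "(\<lambda>p. (fst (fst p) * snd p, snd (fst p))) ` (rect h \<times> cbox 0 1) \<subseteq> rect h"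
      proof clarify
        fix s x u :: real
        assume sx: "(s, x) \<in> rect h" and u: "u \<in> cbox 0 1"
        then have "s \<le> s * u" "s * u \<le> 0"
          using mult_left_mono_neg[of u 1 s] mult_nonpos_nonneg[of s u] by (simp_all add: rect_def)
        then show "(fst (fst ((s, x), u)) * snd ((s, x), u), snd (fst ((s, x), u))) \<in> rect h"
          using sx by (auto simp: rect_def)
      qed
      from continuous_on_compose2[OF assms _ this]
      show ?thesis by (simp add: case_prod_beta continuous_intros)
    qed
  qed
  then show ?thesis
    by (rule continuous_on_eq) (auto simp: eq)
qed

lemma continuous_on_compose_case_prod:
  assumes f: "continuous_on T (\<lambda>(s,x). f s x)" and "continuous_on S a" "continuous_on S b"
    and "\<And>p. p \<in> S \<Longrightarrow> (a p, b p) \<in> T"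
  shows "continuous_on S (\<lambda>p. f (a p) (b p))"
  using continuous_on_compose2[OF f, of S "\<lambda>p. (a p, b p)"] assms(2-)
  by (force intro: continuous_on_Pair)

lemma continuous_on_Hz:
  assumes "continuous_on (rect h) (\<lambda>(s,x). \<phi> s x)"
  shows "continuous_on (rect h) (\<lambda>(\<theta>,x). Hz z \<phi> \<theta> x)"
proof -
  have "continuous_on (rect h) (\<lambda>(s,x). exp (- z * complex_of_real s) * \<phi> s x)"
    using assms unfolding case_prod_beta by (intro continuous_intros)
  from continuous_on_integral_to_zero[OF this] show ?thesis
    unfolding Hz_eq case_prod_beta by (intro continuous_intros)
qed

text \<open>\<open>Hz z \<phi>\<close> solves z u - u' = \<phi> with u(0) = 0. This is the product
  rule applied to the form in \<open>Hz_eq\<close>; the integral with variable lower limit is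
  written as the full integral minus one with variable upper limit, which produces the minus
  sign.\<close>

lemma has_vector_derivative_Hz:
  assumes cont: "continuous_on (rect h) (\<lambda>(s,x). \<phi> s x)"
    and \<theta>: "\<theta> \<in> {-h..0}" and x: "x \<in> {-1..1}"
  shows "((\<lambda>\<theta>. Hz z \<phi> \<theta> x) has_vector_derivative z * Hz z \<phi> \<theta> x - \<phi> \<theta> x) (at \<theta> within {-h..0})"
proof -
  define f where "f = (\<lambda>s. exp (- z * complex_of_real s) * \<phi> s x)"
  have "continuous_on {-h..0} (\<lambda>s. \<phi> s x)"
    using x by (intro continuous_on_compose_case_prod[OF cont] continuous_intros) (auto simp: rect_def)
  then have f: "continuous_on {-h..0} f"
    unfolding f_def by (intro continuous_intros)
  have int: "f integrable_on {-h..0}"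
    by (rule integrable_continuous_real[OF f])
  have diff: "((\<lambda>\<theta>. integral {-h..0} f - integral {-h..\<theta>} f) has_vector_derivative 0 - f \<theta>)
      (at \<theta> within {-h..0})"
    by (intro has_vector_derivative_diff has_vector_derivative_const
        integral_has_vector_derivative[OF f \<theta>])
  have split: "integral {\<theta>..0} f = integral {-h..0} f - integral {-h..\<theta>} f" if "\<theta> \<in> {-h..0}" for \<theta>
    using Henstock_Kurzweil_Integration.integral_combine[OF _ _ int, of \<theta>] that by (simp add: algebra_simps)
  have "((\<lambda>\<theta>. integral {\<theta>..0} f) has_vector_derivative 0 - f \<theta>) (at \<theta> within {-h..0})"
    by (rule has_vector_derivative_transform[OF \<theta> split diff])
  moreover have "((\<lambda>\<theta>. exp (z * complex_of_real \<theta>)) has_vector_derivative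
      z * exp (z * complex_of_real \<theta>)) (at \<theta> within {-h..0})"
    by (rule has_vector_derivative_real_field) (auto intro!: derivative_eq_intros)
  ultimately have "((\<lambda>\<theta>. exp (z * complex_of_real \<theta>) * integral {\<theta>..0} f) has_vector_derivative
      exp (z * complex_of_real \<theta>) * (0 - f \<theta>) + z * exp (z * complex_of_real \<theta>) * integral {\<theta>..0} f)
      (at \<theta> within {-h..0})"
    by (rule has_vector_derivative_mult[rotated])
  moreover have "exp (z * complex_of_real \<theta>) * f \<theta> = \<phi> \<theta> x"
    unfolding f_def by (simp add: exp_minus field_simps)
  ultimately show ?thesis
    unfolding Hz_eq f_def[symmetric] by (simp add: algebra_simps)
qed

section \<open>The delayed integral operator and \<open>hz\<close>\<close>

lemma continuous_on_Jfun:
  assumes "continuous_on S f" "continuous_on S g"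
  shows "continuous_on S (\<lambda>p. Jfun N c \<mu> (f p) (g p))"
  unfolding Jfun_def by (intro continuous_intros assms)

text \<open>For x and r in [-1,1] the distance |x - r| is at most 2, so the delayed argument stays
  in [-(\<tau>0 + 2), 0]; this is where the length \<tau>0 + 2 of the history interval
  matters.\<close>

lemma continuous_on_Jfun_delay:
  assumes "0 \<le> \<tau>0" and cont: "continuous_on (rect (\<tau>0 + 2)) (\<lambda>(s,x). f s x)"
  shows "continuous_on ({-1..1} \<times> {-1..1}) (\<lambda>(x,r). Jfun N c \<mu> x r * f (- \<tau>0 - \<bar>x - r\<bar>) r)"
proof -
  have "continuous_on ({-1..1} \<times> {-1..1}) (\<lambda>p. f (- \<tau>0 - \<bar>fst p - snd p\<bar>) (snd p))"
    using \<open>0 \<le> \<tau>0\<close>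
    by (intro continuous_on_compose_case_prod[OF cont] continuous_intros) (auto simp: rect_def)
  then show ?thesis
    unfolding case_prod_beta by (intro continuous_intros continuous_on_Jfun)
qed

lemma integrable_Jfun_delay:
  assumes "0 \<le> \<tau>0" "continuous_on (rect (\<tau>0 + 2)) (\<lambda>(s,x). f s x)" "x \<in> {-1..1}"
  shows "(\<lambda>r. Jfun N c \<mu> x r * f (- \<tau>0 - \<bar>x - r\<bar>) r) integrable_on {-1..1}"
  using assms(3)
  by (intro integrable_continuous_real continuous_intros
      continuous_on_compose_case_prod[OF continuous_on_Jfun_delay[OF assms(1,2), of N c \<mu>]]) auto

text \<open>With \<theta> = -\<tau>0 - |x - r|, the exponent in \<open>hz\<close> is z(\<theta> -
  s), so the inner integral is \<open>Hz\<close> at the delayed time. Thus \<open>hz\<close> is the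
  inhomogeneity left over when the ansatz is put into the condition at \<theta> = 0.\<close>

lemma hz_eq_Lop_Hz: "hz \<tau>0 N c \<mu> z \<phi> x = \<phi> 0 x + Lop \<tau>0 N c \<mu> (Hz z \<phi>) x"
proof -
  have "integral {- \<tau>0 - \<bar>x - r\<bar>..0} (\<lambda>s. Jfun N c \<mu> x r *
      exp (- z * complex_of_real (\<tau>0 + s) - z * complex_of_real \<bar>x - r\<bar>) * \<phi> s r) =
      Jfun N c \<mu> x r * Hz z \<phi> (- \<tau>0 - \<bar>x - r\<bar>) r" for r
    unfolding Hz_def mult.assoc integral_mult_right
    by (intro arg_cong2[where f = "(*)"] refl integral_cong arg_cong[where f = exp])
      (simp add: algebra_simps)
  then show ?thesis
    unfolding hz_def Lop_def by simp
qed

lemma continuous_on_hz: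
  assumes "0 \<le> \<tau>0" and cont: "continuous_on (rect (\<tau>0 + 2)) (\<lambda>(s,x). \<phi> s x)"
  shows "continuous_on {-1..1} (hz \<tau>0 N c \<mu> z \<phi>)"
proof -
  have "continuous_on {-1..1} (\<lambda>x. \<phi> 0 x)"
    using \<open>0 \<le> \<tau>0\<close>
    by (intro continuous_on_compose_case_prod[OF cont] continuous_intros) (auto simp: rect_def)
  moreover have "continuous_on {-1..1} (Lop \<tau>0 N c \<mu> (Hz z \<phi>))"
    unfolding Lop_def
    using integral_continuous_on_param[of "{-1..1}" "-1::real" 1
        "\<lambda>x r. Jfun N c \<mu> x r * Hz z \<phi> (- \<tau>0 - \<bar>x - r\<bar>) r"]
      continuous_on_Jfun_delay[OF assms(1) continuous_on_Hz[OF cont], of N c \<mu> z]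
    by simp
  ultimately show ?thesis
    unfolding hz_eq_Lop_Hz[abs_def] by (intro continuous_intros)
qed

text \<open>Extension by zero outside the rectangle gives the representative required by
  \<open>Xsp\<close>, so that uniqueness yields an equality of functions. On [-1,1], q is the value
  at \<theta> = 0.\<close>

definition resolvent_ansatz ::
    "real \<Rightarrow> complex \<Rightarrow> (real \<Rightarrow> real \<Rightarrow> complex) \<Rightarrow> (real \<Rightarrow> complex) \<Rightarrow> real \<Rightarrow> real \<Rightarrow> complex" where
  "resolvent_ansatz h z \<phi> q \<theta> x =
     (if (\<theta>, x) \<in> rect h then exp (z * complex_of_real \<theta>) * q x + Hz z \<phi> \<theta> x else 0)"

text \<open>The differential equation \<psi>' = z \<psi> - \<phi> holds whatever q is. Only the
  condition at \<theta> = 0 constrains q: it reads (z + \<alpha>) q = \<phi>(0) + L \<psi>, and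
  splitting L \<psi> into the contributions of q and of \<open>Hz\<close> turns it into the assumed
  integral equation.\<close>

lemma genA_resolvent_ansatz:
  assumes \<tau>0: "0 \<le> \<tau>0" and \<phi>: "\<phi> \<in> Xsp (\<tau>0 + 2)" and q: "continuous_on {-1..1} q"
    and eq: "\<And>x. x \<in> {-1..1} \<Longrightarrow> (z + complex_of_real \<alpha>) * q x = hz \<tau>0 N c \<mu> z \<phi> x +
      integral {-1..1} (\<lambda>r. Jfun N c \<mu> x r * (exp (z * complex_of_real (- \<tau>0 - \<bar>x - r\<bar>)) * q r))"
  shows "genA \<tau>0 \<alpha> N c \<mu> (resolvent_ansatz (\<tau>0 + 2) z \<phi> q)
      (\<lambda>s x. z * resolvent_ansatz (\<tau>0 + 2) z \<phi> q s x - \<phi> s x)"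
proof -
  define h where "h = \<tau>0 + 2"
  define \<psi> where "\<psi> = resolvent_ansatz h z \<phi> q"
  have h: "0 < h" using \<tau>0 by (simp add: h_def)
  have \<phi>c: "continuous_on (rect h) (\<lambda>(s,x). \<phi> s x)"
    and \<phi>0: "\<And>s x. (s,x) \<notin> rect h \<Longrightarrow> \<phi> s x = 0"
    using \<phi> by (auto simp: Xsp_def h_def)
  have eqc: "continuous_on (rect h) (\<lambda>(\<theta>,x). exp (z * complex_of_real \<theta>) * q x)"
    unfolding case_prod_beta
    by (intro continuous_intros continuous_on_compose2[OF q]) (auto simp: rect_def)
  have \<psi>c: "continuous_on (rect h) (\<lambda>(s,x). \<psi> s x)"
  proof (rule continuous_on_eq)
    show "continuous_on (rect h) (\<lambda>p. (case p of (\<theta>,x) \<Rightarrow> exp (z * complex_of_real \<theta>) * q x) +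
        (case p of (\<theta>,x) \<Rightarrow> Hz z \<phi> \<theta> x))"
      by (intro continuous_on_add eqc continuous_on_Hz \<phi>c)
  qed (auto simp: \<psi>_def resolvent_ansatz_def)
  have \<psi>'c: "continuous_on (rect h) (\<lambda>(s,x). z * \<psi> s x - \<phi> s x)"
    using \<psi>c \<phi>c unfolding case_prod_beta by (intro continuous_intros)
  have deriv: "((\<lambda>s. \<psi> s x) has_vector_derivative z * \<psi> s x - \<phi> s x) (at s within {-h..0})"
    if s: "s \<in> {-h..0}" and x: "x \<in> {-1..1}" for s x
  proof -
    have "((\<lambda>\<theta>. exp (z * complex_of_real \<theta>) * q x) has_vector_derivative
        z * exp (z * complex_of_real s) * q x) (at s within {-h..0})"
      by (rule has_vector_derivative_real_field) (auto intro!: derivative_eq_intros)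
    from has_vector_derivative_add[OF this has_vector_derivative_Hz[OF \<phi>c s x, of z]]
    have "((\<lambda>\<theta>. exp (z * complex_of_real \<theta>) * q x + Hz z \<phi> \<theta> x) has_vector_derivative
        z * \<psi> s x - \<phi> s x) (at s within {-h..0})"
      using s x by (simp add: \<psi>_def resolvent_ansatz_def rect_def algebra_simps)
    then show ?thesis
      by (rule has_vector_derivative_transform[OF s, rotated])
        (use x in \<open>auto simp: \<psi>_def resolvent_ansatz_def rect_def\<close>)
  qed
  have bc: "z * \<psi> 0 x - \<phi> 0 x = - complex_of_real \<alpha> * \<psi> 0 x + Lop \<tau>0 N c \<mu> \<psi> x"
    if x: "x \<in> {-1..1}" for x
  proof -
    have "Lop \<tau>0 N c \<mu> \<psi> x = integral {-1..1} (\<lambda>r.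
        Jfun N c \<mu> x r * (exp (z * complex_of_real (- \<tau>0 - \<bar>x - r\<bar>)) * q r) +
        Jfun N c \<mu> x r * Hz z \<phi> (- \<tau>0 - \<bar>x - r\<bar>) r)"
      unfolding Lop_def
      using x \<tau>0 by (intro integral_cong) (auto simp: \<psi>_def resolvent_ansatz_def rect_def h_def algebra_simps)
    also have "\<dots> = integral {-1..1} (\<lambda>r.
        Jfun N c \<mu> x r * (exp (z * complex_of_real (- \<tau>0 - \<bar>x - r\<bar>)) * q r)) + Lop \<tau>0 N c \<mu> (Hz z \<phi>) x"
      unfolding Lop_def
      using integrable_Jfun_delay[OF \<tau>0 eqc[unfolded h_def] x]
        integrable_Jfun_delay[OF \<tau>0 continuous_on_Hz[OF \<phi>c[unfolded h_def]] x]
      by (rule integral_add)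
    finally have "Lop \<tau>0 N c \<mu> \<psi> x = (z + complex_of_real \<alpha>) * q x - \<phi> 0 x"
      using eq[OF x] unfolding hz_eq_Lop_Hz by simp
    moreover have "\<psi> 0 x = q x"
      using h x by (simp add: \<psi>_def resolvent_ansatz_def rect_def Hz_def)
    ultimately show ?thesis by (simp add: algebra_simps)
  qed
  have "\<psi> s x = 0" if "(s, x) \<notin> rect h" for s x
    using that by (simp add: \<psi>_def resolvent_ansatz_def)
  then show ?thesis
    using \<psi>c \<psi>'c \<phi>0 bc X_derivI[OF \<psi>'c deriv]
    unfolding genA_def Xsp_def h_def[symmetric] \<psi>_def[symmetric] by auto
qed

text \<open>The resolvent hypothesis enters through this fact twice: with \<phi> = 0 to show that
  S(z) has trivial kernel, and with the given \<phi> to identify \<psi> with the ansatz.\<close>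

lemma resolvent_set_unique:
  assumes "z \<in> resolvent_set \<tau>0 \<alpha> N c \<mu>" "\<phi> \<in> Xsp (\<tau>0 + 2)"
    and "genA \<tau>0 \<alpha> N c \<mu> \<psi>1 A\<psi>1" "(\<lambda>s x. z * \<psi>1 s x - A\<psi>1 s x) = \<phi>"
    and "genA \<tau>0 \<alpha> N c \<mu> \<psi>2 A\<psi>2" "(\<lambda>s x. z * \<psi>2 s x - A\<psi>2 s x) = \<phi>"
  shows "\<psi>1 = \<psi>2"
  using assms unfolding resolvent_set_def by blast

subsection \<open>Convolution with exponentials\<close>

text \<open>The shift b covers exponentials of x - r with x fixed. Pure exponentials are later
  written with \<open>+ 0\<close> so that they match this form.\<close>

lemma exp_of_real_has_vector_derivative:
  "((\<lambda>r. exp (a * complex_of_real r + b)) has_vector_derivative a * exp (a * complex_of_real r + b))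
    (at r within S)"
  by (rule has_vector_derivative_real_field) (auto intro!: derivative_eq_intros)

text \<open>Variation of constants: the functions E are the exponential terms of q = g + sum E.
  After division by k + R, the sum of the E times an exponential is a primitive of the convolution
  integrand, because the condition on v turns the inhomogeneities into exactly g.\<close>
lemma integral_exp_left:
  fixes E :: "'k \<Rightarrow> real \<Rightarrow> complex"
  assumes "finite K" "a \<le> x"
    and deriv: "\<And>\<sigma> r. \<sigma> \<in> K \<Longrightarrow> r \<in> {a..x} \<Longrightarrow>
      (E \<sigma> has_vector_derivative R \<sigma> * E \<sigma> r + v \<sigma> * g r) (at r within {a..x})"
    and nz: "\<And>\<sigma>. \<sigma> \<in> K \<Longrightarrow> k + R \<sigma> \<noteq> 0"
    and v: "(\<Sum>\<sigma>\<in>K. v \<sigma> / (k + R \<sigma>)) = 1"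
    and bd: "(\<Sum>\<sigma>\<in>K. E \<sigma> a / (k + R \<sigma>)) = 0"
  shows "((\<lambda>r. exp (- k * complex_of_real (x - r)) * (g r + (\<Sum>\<sigma>\<in>K. E \<sigma> r)))
      has_integral (\<Sum>\<sigma>\<in>K. E \<sigma> x / (k + R \<sigma>))) {a..x}"
proof -
  define e where "e r = exp (k * complex_of_real r + (- k * complex_of_real x))" for r
  define F where "F r = e r * (\<Sum>\<sigma>\<in>K. E \<sigma> r / (k + R \<sigma>))" for r
  have "(F has_vector_derivative e r * (g r + (\<Sum>\<sigma>\<in>K. E \<sigma> r))) (at r within {a..x})"
    if r: "r \<in> {a..x}" for r
  proof -
    have "(F has_vector_derivative e r * (\<Sum>\<sigma>\<in>K. (R \<sigma> * E \<sigma> r + v \<sigma> * g r) / (k + R \<sigma>)) +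
        k * e r * (\<Sum>\<sigma>\<in>K. E \<sigma> r / (k + R \<sigma>))) (at r within {a..x})"
      unfolding F_def e_def
      by (intro has_vector_derivative_mult exp_of_real_has_vector_derivative
          has_vector_derivative_sum has_vector_derivative_divide deriv r)
    moreover have "(\<Sum>\<sigma>\<in>K. (R \<sigma> * E \<sigma> r + v \<sigma> * g r) / (k + R \<sigma>)) + k * (\<Sum>\<sigma>\<in>K. E \<sigma> r / (k + R \<sigma>)) =
        g r * (\<Sum>\<sigma>\<in>K. v \<sigma> / (k + R \<sigma>)) + (\<Sum>\<sigma>\<in>K. E \<sigma> r)"
      unfolding sum_distrib_left sum.distrib[symmetric]
    proof (intro sum.cong refl)
      fix \<sigma> assume "\<sigma> \<in> K"
      then have "k * E \<sigma> r / (k + R \<sigma>) + R \<sigma> * E \<sigma> r / (k + R \<sigma>) = E \<sigma> r"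
        using nz[of \<sigma>] by (simp add: add_divide_distrib[symmetric] distrib_right[symmetric])
      moreover have "(R \<sigma> * E \<sigma> r + v \<sigma> * g r) / (k + R \<sigma>) + k * (E \<sigma> r / (k + R \<sigma>)) =
          g r * (v \<sigma> / (k + R \<sigma>)) +
          (k * E \<sigma> r / (k + R \<sigma>) + R \<sigma> * E \<sigma> r / (k + R \<sigma>))"
        by (simp add: add_divide_distrib mult.commute)
      ultimately show "(R \<sigma> * E \<sigma> r + v \<sigma> * g r) / (k + R \<sigma>) + k * (E \<sigma> r / (k + R \<sigma>)) =
          g r * (v \<sigma> / (k + R \<sigma>)) + E \<sigma> r" by simp
    qed
    moreover have "e r * A + k * e r * B = e r * (A + k * B)" for A B
      by (simp add: distrib_left mult.left_commute)
    ultimately show ?thesis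
      unfolding v by simp
  qed
  from fundamental_theorem_of_calculus[OF \<open>a \<le> x\<close> this]
  have "((\<lambda>r. e r * (g r + (\<Sum>\<sigma>\<in>K. E \<sigma> r))) has_integral F x - F a) {a..x}" by simp
  \<comment> \<open>\<open>bd\<close> makes F vanish at a, and e equals 1 at x, so only the sum at x
    remains.\<close>
  then show ?thesis
    by (simp add: F_def bd e_def algebra_simps)
qed

text \<open>Mirror image of \<open>integral_exp_left\<close>, with k replaced by -k and the boundary
  term vanishing at the right end. The primitive naturally has the denominators R - k; changing
  their sign turns the value -1 in the condition on v into the 1 needed to recover g.\<close>

lemma integral_exp_right:
  fixes E :: "'k \<Rightarrow> real \<Rightarrow> complex"
  assumes "finite K" "x \<le> b"
    and deriv: "\<And>\<sigma> r. \<sigma> \<in> K \<Longrightarrow> r \<in> {x..b} \<Longrightarrow>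
      (E \<sigma> has_vector_derivative R \<sigma> * E \<sigma> r + v \<sigma> * g r) (at r within {x..b})"
    and nz: "\<And>\<sigma>. \<sigma> \<in> K \<Longrightarrow> k - R \<sigma> \<noteq> 0"
    and v: "(\<Sum>\<sigma>\<in>K. v \<sigma> / (k - R \<sigma>)) = -1"
    and bd: "(\<Sum>\<sigma>\<in>K. E \<sigma> b / (k - R \<sigma>)) = 0"
  shows "((\<lambda>r. exp (- k * complex_of_real (r - x)) * (g r + (\<Sum>\<sigma>\<in>K. E \<sigma> r)))
      has_integral (\<Sum>\<sigma>\<in>K. E \<sigma> x / (k - R \<sigma>))) {x..b}"
proof -
  define e where "e r = exp (- k * complex_of_real r + k * complex_of_real x)" for r
  define F where "F r = e r * (\<Sum>\<sigma>\<in>K. E \<sigma> r / (R \<sigma> - k))" for r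
  have neg: "y / (R \<sigma> - k) = - (y / (k - R \<sigma>))" for y \<sigma>
    by (metis minus_diff_eq minus_divide_right)
  have "(F has_vector_derivative e r * (g r + (\<Sum>\<sigma>\<in>K. E \<sigma> r))) (at r within {x..b})"
    if r: "r \<in> {x..b}" for r
  proof -
    have "(F has_vector_derivative e r * (\<Sum>\<sigma>\<in>K. (R \<sigma> * E \<sigma> r + v \<sigma> * g r) / (R \<sigma> - k)) +
        - k * e r * (\<Sum>\<sigma>\<in>K. E \<sigma> r / (R \<sigma> - k))) (at r within {x..b})"
      unfolding F_def e_def
      by (intro has_vector_derivative_mult exp_of_real_has_vector_derivative
          has_vector_derivative_sum has_vector_derivative_divide deriv r)
    moreover have "(\<Sum>\<sigma>\<in>K. (R \<sigma> * E \<sigma> r + v \<sigma> * g r) / (R \<sigma> - k)) + - k * (\<Sum>\<sigma>\<in>K. E \<sigma> r / (R \<sigma> - k)) =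
        g r * (\<Sum>\<sigma>\<in>K. v \<sigma> / (R \<sigma> - k)) + (\<Sum>\<sigma>\<in>K. E \<sigma> r)"
      unfolding sum_distrib_left sum.distrib[symmetric]
    proof (intro sum.cong refl)
      fix \<sigma> assume "\<sigma> \<in> K"
      then have "R \<sigma> * E \<sigma> r / (R \<sigma> - k) - k * E \<sigma> r / (R \<sigma> - k) = E \<sigma> r"
        using nz[of \<sigma>] by (simp add: diff_divide_distrib[symmetric] left_diff_distrib[symmetric])
      moreover have "(R \<sigma> * E \<sigma> r + v \<sigma> * g r) / (R \<sigma> - k) + - k * (E \<sigma> r / (R \<sigma> - k)) =
          g r * (v \<sigma> / (R \<sigma> - k)) +
          (R \<sigma> * E \<sigma> r / (R \<sigma> - k) - k * E \<sigma> r / (R \<sigma> - k))"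
        by (simp add: add_divide_distrib mult.commute)
      ultimately show "(R \<sigma> * E \<sigma> r + v \<sigma> * g r) / (R \<sigma> - k) + - k * (E \<sigma> r / (R \<sigma> - k)) =
          g r * (v \<sigma> / (R \<sigma> - k)) + E \<sigma> r" by simp
    qed
    moreover have "(\<Sum>\<sigma>\<in>K. v \<sigma> / (R \<sigma> - k)) = 1"
      unfolding neg sum_negf v by simp
    ultimately show ?thesis
      by (simp add: algebra_simps)
  qed
  from fundamental_theorem_of_calculus[OF \<open>x \<le> b\<close> this]
  have "((\<lambda>r. e r * (g r + (\<Sum>\<sigma>\<in>K. E \<sigma> r))) has_integral F b - F x) {x..b}" by simp
  then show ?thesis
    by (simp add: F_def neg sum_negf bd e_def algebra_simps)
qed

text \<open>Splitting at x leaves one sum from each side, and 1/(k + R) + 1/(k - R) = 2k/(k^2 -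
  R^2). Hence convolution with the kernel multiplies each E by a scalar, and g disappears from the
  result.\<close>

lemma integral_exp_abs:
  fixes E :: "'k \<Rightarrow> real \<Rightarrow> complex"
  assumes "finite K" and x: "x \<in> {a..b}"
    and deriv: "\<And>\<sigma> r. \<sigma> \<in> K \<Longrightarrow> r \<in> {a..b} \<Longrightarrow>
      (E \<sigma> has_vector_derivative R \<sigma> * E \<sigma> r + v \<sigma> * g r) (at r within {a..b})"
    and nz: "\<And>\<sigma>. \<sigma> \<in> K \<Longrightarrow> k + R \<sigma> \<noteq> 0 \<and> k - R \<sigma> \<noteq> 0"
    and v: "(\<Sum>\<sigma>\<in>K. v \<sigma> / (k + R \<sigma>)) = 1" "(\<Sum>\<sigma>\<in>K. v \<sigma> / (k - R \<sigma>)) = -1"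
    and bd: "(\<Sum>\<sigma>\<in>K. E \<sigma> a / (k + R \<sigma>)) = 0" "(\<Sum>\<sigma>\<in>K. E \<sigma> b / (k - R \<sigma>)) = 0"
  shows "((\<lambda>r. exp (- k * complex_of_real \<bar>x - r\<bar>) * (g r + (\<Sum>\<sigma>\<in>K. E \<sigma> r)))
      has_integral (\<Sum>\<sigma>\<in>K. E \<sigma> x * (2 * k / (k\<^sup>2 - (R \<sigma>)\<^sup>2)))) {a..b}"
proof -
  let ?f = "\<lambda>r. exp (- k * complex_of_real \<bar>x - r\<bar>) * (g r + (\<Sum>\<sigma>\<in>K. E \<sigma> r))"
  have x': "a \<le> x" "x \<le> b" using x by auto
  have d: "(E \<sigma> has_vector_derivative R \<sigma> * E \<sigma> r + v \<sigma> * g r) (at r within S)"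
    if "\<sigma> \<in> K" "r \<in> S" "S \<subseteq> {a..b}" for \<sigma> r S
    using deriv[of \<sigma> r] that has_vector_derivative_within_subset by blast
  have "((\<lambda>r. exp (- k * complex_of_real (x - r)) * (g r + (\<Sum>\<sigma>\<in>K. E \<sigma> r)))
      has_integral (\<Sum>\<sigma>\<in>K. E \<sigma> x / (k + R \<sigma>))) {a..x}"
    using assms(1) x' v bd nz by (intro integral_exp_left[where v = v] d) auto
  then have 1: "(?f has_integral (\<Sum>\<sigma>\<in>K. E \<sigma> x / (k + R \<sigma>))) {a..x}"
    by (rule has_integral_eq[rotated]) auto
  have "((\<lambda>r. exp (- k * complex_of_real (r - x)) * (g r + (\<Sum>\<sigma>\<in>K. E \<sigma> r)))
      has_integral (\<Sum>\<sigma>\<in>K. E \<sigma> x / (k - R \<sigma>))) {x..b}"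
    using assms(1) x' v bd nz by (intro integral_exp_right[where v = v] d) auto
  then have 2: "(?f has_integral (\<Sum>\<sigma>\<in>K. E \<sigma> x / (k - R \<sigma>))) {x..b}"
    by (rule has_integral_eq[rotated]) auto
  have "(\<Sum>\<sigma>\<in>K. E \<sigma> x / (k + R \<sigma>)) + (\<Sum>\<sigma>\<in>K. E \<sigma> x / (k - R \<sigma>)) =
      (\<Sum>\<sigma>\<in>K. E \<sigma> x * (2 * k / (k\<^sup>2 - (R \<sigma>)\<^sup>2)))"
    unfolding sum.distrib[symmetric]
  proof (intro sum.cong refl)
    fix \<sigma> assume "\<sigma> \<in> K"
    then have "E \<sigma> x / (k + R \<sigma>) + E \<sigma> x / (k - R \<sigma>) =
        (E \<sigma> x * (k - R \<sigma>) + E \<sigma> x * (k + R \<sigma>)) / ((k + R \<sigma>) * (k - R \<sigma>))"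
      using nz by (intro add_frac_eq) auto
    also have "(k + R \<sigma>) * (k - R \<sigma>) = k\<^sup>2 - (R \<sigma>)\<^sup>2"
      by (simp add: power2_eq_square algebra_simps)
    also have "E \<sigma> x * (k - R \<sigma>) + E \<sigma> x * (k + R \<sigma>) = E \<sigma> x * (2 * k)"
      by (simp add: algebra_simps)
    finally show "E \<sigma> x / (k + R \<sigma>) + E \<sigma> x / (k - R \<sigma>) = E \<sigma> x * (2 * k / (k\<^sup>2 - (R \<sigma>)\<^sup>2))"
      by simp
  qed
  with has_integral_combine[OF x' 1 2] show ?thesis by simp
qed

text \<open>The reference point may lie on either side of x. In both cases \<open>oint\<close> is a
  difference of integrals that start at a, which reduces the claim to the fundamental theorem of
  calculus.\<close>

lemma oint_has_vector_derivative:
  assumes f: "continuous_on {a..b} f" and x0: "x0 \<in> {a..b}" and x: "x \<in> {a..b}"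
  shows "((\<lambda>x. oint x0 x f) has_vector_derivative f x) (at x within {a..b})"
proof -
  have int: "f integrable_on {u..v}" if "u \<in> {a..b}" "v \<in> {a..b}" for u v
    using that by (intro integrable_continuous_real continuous_on_subset[OF f]) auto
  have split: "oint x0 y f = integral {a..y} f - integral {a..x0} f" if y: "y \<in> {a..b}" for y
  proof (cases "x0 \<le> y")
    case True
    then show ?thesis
      using Henstock_Kurzweil_Integration.integral_combine[of a x0 y f] x0 y int[of a y]
      by (auto simp: oint_def algebra_simps)
  next
    case False
    then show ?thesis
      using Henstock_Kurzweil_Integration.integral_combine[of a y x0 f] x0 y int[of a x0]
      by (auto simp: oint_def algebra_simps)
  qed
  have diff: "((\<lambda>y. integral {a..y} f - integral {a..x0} f) has_vector_derivative f x - 0)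
      (at x within {a..b})"
    by (intro has_vector_derivative_diff has_vector_derivative_const integral_has_vector_derivative f x)
  show ?thesis
    using has_vector_derivative_transform[OF x split diff] by simp
qed

subsection \<open>The matrices T, S and P\<close>

lemma minv_props:
  assumes "A \<in> carrier_mat n n" "invertible_mat A"
  shows "minv A \<in> carrier_mat n n" "A * minv A = 1\<^sub>m n"
proof -
  have "\<exists>B. inverts_mat A B \<and> inverts_mat B A"
    using assms(2) by (simp add: invertible_mat_def)
  then have *: "inverts_mat A (minv A)" "inverts_mat (minv A) A"
    unfolding minv_def by (metis (mono_tags, lifting) someI_ex)+
  then show "A * minv A = 1\<^sub>m n"
    using assms(1) by (auto simp: inverts_mat_def)
  \<comment> \<open>The choice in \<open>minv\<close> does not fix the shape: the column count is
    read off from the right inverse identity and the row count from the left one.\<close>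
  then have "dim_col (minv A) = n"
    by (metis index_mult_mat(3) index_one_mat(3))
  moreover have "dim_row (minv A) = n"
    using *(2) assms(1) unfolding inverts_mat_def
    by (metis carrier_matD(2) index_mult_mat(3) index_one_mat(3))
  ultimately show "minv A \<in> carrier_mat n n" by auto
qed

lemma invertible_mat_if_kernel_zero:
  fixes A :: "'a::field mat"
  assumes A: "A \<in> carrier_mat n n"
    and ker: "\<And>v. v \<in> carrier_vec n \<Longrightarrow> A *\<^sub>v v = 0\<^sub>v n \<Longrightarrow> v = 0\<^sub>v n"
  shows "invertible_mat A"
proof -
  have "det A \<noteq> 0"
    using det_0_iff_vec_prod_zero_field[OF A] ker by blast
  from det_non_zero_imp_unit[OF A this] obtain B where
    "B \<in> carrier_mat n n" "B * A = 1\<^sub>m n" "A * B = 1\<^sub>m n"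
    by (auto simp: Units_def ring_mat_simps)
  then show ?thesis
    using A by (auto simp: invertible_mat_def inverts_mat_def)
qed

lemma mult_mat_vec_nth:
  assumes "A \<in> carrier_mat m n" "v \<in> carrier_vec n" "i < m"
  shows "(A *\<^sub>v v) $ i = (\<Sum>j<n. A $$ (i,j) * v $ j)"
  using assms by (auto simp: scalar_prod_def lessThan_atLeast0 intro!: sum.cong)

text \<open>Multiply the row vector identity w A = 0 on the right by the inverse of A, written in
  coordinates.\<close>

lemma left_kernel_zero:
  assumes A: "A \<in> carrier_mat n n" "invertible_mat A"
    and w: "\<And>j. j < n \<Longrightarrow> (\<Sum>i<n. w i * A $$ (i,j)) = 0" and k: "k < n"
  shows "w k = (0::complex)"
proof -
  let ?B = "minv A"
  note B = minv_props[OF A]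
  have AB: "(\<Sum>j<n. A $$ (i,j) * ?B $$ (j,k)) = (if i = k then 1 else 0)" if "i < n" for i
  proof -
    have "(A * ?B) $$ (i,k) = (\<Sum>j<n. A $$ (i,j) * ?B $$ (j,k))"
      using A(1) B(1) that k by (auto simp: scalar_prod_def lessThan_atLeast0 intro!: sum.cong)
    then show ?thesis using B(2) that k by auto
  qed
  have "w k = (\<Sum>i<n. w i * (\<Sum>j<n. A $$ (i,j) * ?B $$ (j,k)))"
    using k by (simp add: AB if_distrib sum.delta' cong: if_cong)
  also have "\<dots> = (\<Sum>j<n. (\<Sum>i<n. w i * A $$ (i,j)) * ?B $$ (j,k))"
    unfolding sum_distrib_left sum_distrib_right mult.assoc by (rule sum.swap)
  also have "\<dots> = 0" using w by simp
  finally show ?thesis .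
qed

text \<open>With the columns indexed by the 2N signed roots, both block rows of T(z) and S(z) become
  uniform formulas.\<close>
definition signed_root :: "nat \<Rightarrow> (nat \<Rightarrow> complex) \<Rightarrow> nat \<Rightarrow> complex" where
  "signed_root N \<rho> \<sigma> = (if \<sigma> < N then \<rho> \<sigma> else - \<rho> (\<sigma> - N))"

lemma sum_lessThan_add: "(\<Sum>\<sigma><m + n. f \<sigma>) = (\<Sum>i<m. f i) + (\<Sum>i<n. f (m + i))"
  for f :: "nat \<Rightarrow> 'a::comm_monoid_add"
  by (induction n) (auto simp: add.assoc)

lemma Tmat_index:
  assumes "i < 2 * N" "\<sigma> < 2 * N"
  shows "Tmat N \<mu> \<rho> z $$ (i, \<sigma>) =
    (if i < N then 1 / (kf \<mu> z i - signed_root N \<rho> \<sigma>) else 1 / (kf \<mu> z (i - N) + signed_root N \<rho> \<sigma>))"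
  using assms by (auto simp: Tmat_def Let_def signed_root_def)

lemma Tmat_carrier: "Tmat N \<mu> \<rho> z \<in> carrier_mat (2 * N) (2 * N)"
  by (auto simp: Tmat_def Let_def)

lemma Smat_index:
  assumes "i < 2 * N" "\<sigma> < 2 * N"
  shows "Smat N \<mu> \<rho> z $$ (i, \<sigma>) =
    (if i < N then exp (signed_root N \<rho> \<sigma>) / (kf \<mu> z i - signed_root N \<rho> \<sigma>)
     else exp (- signed_root N \<rho> \<sigma>) / (kf \<mu> z (i - N) + signed_root N \<rho> \<sigma>))"
  using assms by (auto simp: Smat_def Sminus_def Splus_def signed_root_def kf_def)

lemma Smat_carrier: "Smat N \<mu> \<rho> z \<in> carrier_mat (2 * N) (2 * N)"
  by (auto simp: Smat_def Sminus_def Splus_def)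

lemma Smid_carrier: "Smid N \<mu> \<rho> z \<in> carrier_mat (2 * N) (4 * N)"
  by (auto simp: Smid_def Sminus_def Splus_def)

lemma Smid_index:
  assumes "i < 2 * N" "\<sigma> < 4 * N"
  shows "Smid N \<mu> \<rho> z $$ (i, \<sigma>) =
    (if i < N then if \<sigma> < 2 * N then Smat N \<mu> \<rho> z $$ (i, \<sigma>) else 0
     else if \<sigma> < 2 * N then 0 else Smat N \<mu> \<rho> z $$ (i, \<sigma> - 2 * N))"
  using assms by (auto simp: Smid_def Smat_def Sminus_def Splus_def numeral_3_eq_3 mult_2)

text \<open>The first N rows of the result are those of S applied to a, the last N those of S
  applied to b. This lets one constant vector cancel boundary data taken at two different
  points.\<close>

lemma Smid_mult_append:
  assumes "a \<in> carrier_vec (2 * N)" "b \<in> carrier_vec (2 * N)" "i < 2 * N"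
  shows "(Smid N \<mu> \<rho> z *\<^sub>v (a @\<^sub>v b)) $ i =
    (if i < N then (Smat N \<mu> \<rho> z *\<^sub>v a) $ i else (Smat N \<mu> \<rho> z *\<^sub>v b) $ i)"
proof -
  have ab: "a @\<^sub>v b \<in> carrier_vec (4 * N)"
    using append_carrier_vec[OF assms(1,2)] by simp
  have "(Smid N \<mu> \<rho> z *\<^sub>v (a @\<^sub>v b)) $ i = (\<Sum>\<sigma><2 * (2 * N). Smid N \<mu> \<rho> z $$ (i, \<sigma>) * (a @\<^sub>v b) $ \<sigma>)"
    using mult_mat_vec_nth[OF Smid_carrier ab assms(3)] by simp
  also have "\<dots> = (\<Sum>\<sigma><2 * N. Smid N \<mu> \<rho> z $$ (i, \<sigma>) * a $ \<sigma>) +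
      (\<Sum>\<sigma><2 * N. Smid N \<mu> \<rho> z $$ (i, 2 * N + \<sigma>) * b $ \<sigma>)"
    unfolding mult_2[of "2 * N"] sum_lessThan_add using assms by (intro arg_cong2[where f = "(+)"] sum.cong) auto
  finally show ?thesis
    using assms by (simp add: Smid_index mult_mat_vec_nth[OF Smat_carrier])
qed

lemma Pblock_mult:
  assumes "w \<in> carrier_vec (2 * N)" "\<sigma> < 2 * N"
  shows "(Pblock N \<rho> x *\<^sub>v w) $ \<sigma> = exp (- signed_root N \<rho> \<sigma> * complex_of_real x) * w $ \<sigma>"
proof -
  have c: "Pblock N \<rho> x \<in> carrier_mat (2 * N) (2 * N)"
    by (auto simp: Pblock_def Pminus_def Pplus_def mat_diag_def)
  have "Pblock N \<rho> x $$ (\<sigma>, j) = (if j = \<sigma> then exp (- signed_root N \<rho> \<sigma> * complex_of_real x) else 0)"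
    if "j < 2 * N" for j
    using that assms(2) by (auto simp: Pblock_def Pminus_def Pplus_def mat_diag_def signed_root_def)
  then show ?thesis
    using assms by (simp add: mult_mat_vec_nth[OF c] if_distrib[of "\<lambda>x. x * _"] cong: if_cong)
qed

subsection \<open>Solution formula\<close>

text \<open>Dividing by the product of the w^2 - k_j^2, nonzero by assumption, puts the
  characteristic equation into partial fraction form. The sum on the left is built from the scalars
  produced by \<open>integral_exp_abs\<close>.\<close>

lemma charP_root:
  assumes root: "charP \<tau>0 \<alpha> N c \<mu> z w = 0" and nz: "\<And>j. j < N \<Longrightarrow> (kf \<mu> z j)\<^sup>2 \<noteq> w\<^sup>2"
  shows "(\<Sum>j<N. c j * (2 * kf \<mu> z j / ((kf \<mu> z j)\<^sup>2 - w\<^sup>2))) =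
    exp (z * complex_of_real \<tau>0) * (z + complex_of_real \<alpha>)"
proof -
  define p where "p j = w\<^sup>2 - (kf \<mu> z j)\<^sup>2" for j
  have p: "p j \<noteq> 0" if "j < N" for j using nz[OF that] by (simp add: p_def)
  define P where "P = (\<Prod>j<N. p j)"
  have P: "P \<noteq> 0" using p by (auto simp: P_def)
  have "(\<Prod>j\<in>{..<N} - {i}. p j) = P / p i" if "i < N" for i
    unfolding P_def using that p[OF that] by (subst prod.remove[of _ i]) auto
  then have "charP \<tau>0 \<alpha> N c \<mu> z w = 1/2 * exp (z * complex_of_real \<tau>0) * (z + complex_of_real \<alpha>) * P
      + (\<Sum>i<N. c i * kf \<mu> z i * (P / p i))"
    unfolding charP_def p_def[symmetric] P_def[symmetric] by simp
  also have "(\<Sum>i<N. c i * kf \<mu> z i * (P / p i)) =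
      - (1/2) * (\<Sum>j<N. c j * (2 * kf \<mu> z j / ((kf \<mu> z j)\<^sup>2 - w\<^sup>2))) * P"
    unfolding sum_distrib_left sum_distrib_right
  proof (intro sum.cong refl)
    fix i assume "i \<in> {..<N}"
    have "(kf \<mu> z i)\<^sup>2 - w\<^sup>2 = - p i" by (simp add: p_def)
    then show "c i * kf \<mu> z i * (P / p i) =
        - (1/2) * (c i * (2 * kf \<mu> z i / ((kf \<mu> z i)\<^sup>2 - w\<^sup>2))) * P"
      by simp
  qed
  finally have "(exp (z * complex_of_real \<tau>0) * (z + complex_of_real \<alpha>) -
      (\<Sum>j<N. c j * (2 * kf \<mu> z j / ((kf \<mu> z j)\<^sup>2 - w\<^sup>2)))) * P = 0"
    using root by (simp add: algebra_simps)
  then show ?thesis using P by simp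
qed

text \<open>The delay factor merges with the exponential in \<mu> j into exp(-k_j |x - r|) times the
  constant exp(-z \<tau>0). Applying \<open>integral_exp_abs\<close> for each j and exchanging the
  sums leaves, for each E, the sum in \<open>root\<close>, whose factor exp(z \<tau>0) cancels that
  constant.\<close>

lemma integral_Jfun_exp:
  fixes E :: "'k \<Rightarrow> real \<Rightarrow> complex"
  assumes K: "finite K" and x: "x \<in> {-1..1}"
    and deriv: "\<And>\<sigma> r. \<sigma> \<in> K \<Longrightarrow> r \<in> {-1..1} \<Longrightarrow>
      (E \<sigma> has_vector_derivative R \<sigma> * E \<sigma> r + v \<sigma> * g r) (at r within {-1..1})"
    and nz: "\<And>\<sigma> j. \<sigma> \<in> K \<Longrightarrow> j < N \<Longrightarrow> kf \<mu> z j + R \<sigma> \<noteq> 0 \<and> kf \<mu> z j - R \<sigma> \<noteq> 0"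
    and v: "\<And>j. j < N \<Longrightarrow> (\<Sum>\<sigma>\<in>K. v \<sigma> / (kf \<mu> z j + R \<sigma>)) = 1"
      "\<And>j. j < N \<Longrightarrow> (\<Sum>\<sigma>\<in>K. v \<sigma> / (kf \<mu> z j - R \<sigma>)) = -1"
    and bd: "\<And>j. j < N \<Longrightarrow> (\<Sum>\<sigma>\<in>K. E \<sigma> (-1) / (kf \<mu> z j + R \<sigma>)) = 0"
      "\<And>j. j < N \<Longrightarrow> (\<Sum>\<sigma>\<in>K. E \<sigma> 1 / (kf \<mu> z j - R \<sigma>)) = 0"
    and root: "\<And>\<sigma>. \<sigma> \<in> K \<Longrightarrow> (\<Sum>j<N. c j * (2 * kf \<mu> z j / ((kf \<mu> z j)\<^sup>2 - (R \<sigma>)\<^sup>2))) =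
      exp (z * complex_of_real \<tau>0) * (z + complex_of_real \<alpha>)"
  shows "integral {-1..1} (\<lambda>r. Jfun N c \<mu> x r *
      (exp (z * complex_of_real (- \<tau>0 - \<bar>x - r\<bar>)) * (g r + (\<Sum>\<sigma>\<in>K. E \<sigma> r)))) =
    (z + complex_of_real \<alpha>) * (\<Sum>\<sigma>\<in>K. E \<sigma> x)"
proof -
  let ?q = "\<lambda>r. g r + (\<Sum>\<sigma>\<in>K. E \<sigma> r)"
  let ?e = "exp (- (z * complex_of_real \<tau>0))"
  let ?m = "\<lambda>j \<sigma>. 2 * kf \<mu> z j / ((kf \<mu> z j)\<^sup>2 - (R \<sigma>)\<^sup>2)"
  have "((\<lambda>r. \<Sum>j<N. ?e * c j * (exp (- kf \<mu> z j * complex_of_real \<bar>x - r\<bar>) * ?q r)) has_integral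
      (\<Sum>j<N. ?e * c j * (\<Sum>\<sigma>\<in>K. E \<sigma> x * ?m j \<sigma>))) {-1..1}"
    using K x deriv nz v bd
    by (intro has_integral_sum has_integral_mult_right integral_exp_abs[where v = v]) auto
  moreover have "Jfun N c \<mu> x r * (exp (z * complex_of_real (- \<tau>0 - \<bar>x - r\<bar>)) * ?q r) =
      (\<Sum>j<N. ?e * c j * (exp (- kf \<mu> z j * complex_of_real \<bar>x - r\<bar>) * ?q r))" for r
  proof -
    have "exp (- \<mu> j * complex_of_real \<bar>x - r\<bar>) * exp (z * complex_of_real (- \<tau>0 - \<bar>x - r\<bar>)) =
        ?e * exp (- kf \<mu> z j * complex_of_real \<bar>x - r\<bar>)" for j
      unfolding exp_add[symmetric] by (simp add: kf_def algebra_simps)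
    moreover have "a * b * (d * f) = a * (b * d) * f" for a b d f :: complex
      by (simp only: mult_ac)
    ultimately have "c j * exp (- \<mu> j * complex_of_real \<bar>x - r\<bar>) *
        (exp (z * complex_of_real (- \<tau>0 - \<bar>x - r\<bar>)) * ?q r) =
        ?e * c j * (exp (- kf \<mu> z j * complex_of_real \<bar>x - r\<bar>) * ?q r)" for j
      by (simp only: mult_ac)
    then show ?thesis
      unfolding Jfun_def sum_distrib_right by (intro sum.cong refl) blast
  qed
  ultimately have "integral {-1..1} (\<lambda>r. Jfun N c \<mu> x r *
      (exp (z * complex_of_real (- \<tau>0 - \<bar>x - r\<bar>)) * ?q r)) =
      (\<Sum>j<N. ?e * c j * (\<Sum>\<sigma>\<in>K. E \<sigma> x * ?m j \<sigma>))"
    by (simp only: integral_unique)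
  also have "\<dots> = (\<Sum>\<sigma>\<in>K. ?e * E \<sigma> x * (\<Sum>j<N. c j * ?m j \<sigma>))"
    unfolding sum_distrib_left by (subst sum.swap) (intro sum.cong refl, simp only: mult_ac)
  also have "\<dots> = (\<Sum>\<sigma>\<in>K. (z + complex_of_real \<alpha>) * E \<sigma> x)"
    by (intro sum.cong refl) (simp only: root, simp add: exp_minus)
  finally show ?thesis by (simp add: sum_distrib_left)
qed

text \<open>\<open>minv\<close> is meaningful only for invertible matrices, so invertibility of S(z)
  is part of the conclusion. The condition \<open>\<rho> i \<noteq> - \<rho> j\<close> includes i =
  j and thereby excludes the root zero.\<close>

theorem theorem3p19:
  fixes \<tau>0 \<alpha> :: real and N :: nat and c \<mu> \<rho> :: "nat \<Rightarrow> complex" and z :: complex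
  assumes "\<tau>0 \<ge> 0" and "\<alpha> > 0" and "N \<ge> 1"
    and "\<forall>i<N. c i \<noteq> 0"
    and "inj_on \<mu> {..<N}"
    and "z \<in> resolvent_set \<tau>0 \<alpha> N c \<mu>"
    and "z \<notin> Sset N \<mu>"
    and "\<forall>i<N. charP \<tau>0 \<alpha> N c \<mu> z (\<rho> i) = 0 \<and> charP \<tau>0 \<alpha> N c \<mu> z (- \<rho> i) = 0"
    and "\<forall>w. charP \<tau>0 \<alpha> N c \<mu> z w = 0 \<longrightarrow> (\<exists>i<N. w = \<rho> i \<or> w = - \<rho> i)"
    and "\<forall>i<N. \<forall>j<N. \<rho> i \<noteq> - \<rho> j \<and> (i \<noteq> j \<longrightarrow> \<rho> i \<noteq> \<rho> j)"
    and "\<forall>i<N. \<forall>j<N. kf \<mu> z j \<noteq> \<rho> i \<and> kf \<mu> z j \<noteq> - \<rho> i"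
    and "invertible_mat (Tmat N \<mu> \<rho> z)"
  shows "\<forall>\<phi>\<in>Xsp (\<tau>0 + 2). \<forall>\<psi> A\<psi>.
           genA \<tau>0 \<alpha> N c \<mu> \<psi> A\<psi> \<and> (\<lambda>s x. z * \<psi> s x - A\<psi> s x) = \<phi> \<longrightarrow>
             invertible_mat (Smat N \<mu> \<rho> z) \<and>
             (\<forall>x0\<in>{-1..1}. \<forall>\<theta>\<in>{-(\<tau>0 + 2)..0}. \<forall>x\<in>{-1..1}.
                \<psi> \<theta> x = exp (z * complex_of_real \<theta>) * qz \<tau>0 \<alpha> N c \<mu> \<rho> z \<phi> x0 x + Hz z \<phi> \<theta> x)"
proof -
  define R where "R = signed_root N \<rho>"
  define k where "k = kf \<mu> z"
  define v where "v = minv (Tmat N \<mu> \<rho> z) *\<^sub>v mones N"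
  \<comment> \<open>\<open>?J q\<close> is L applied to the function exp(z \<theta>) q(x).\<close>
  let ?J = "\<lambda>q x. integral {-1..1} (\<lambda>r. Jfun N c \<mu> x r * (exp (z * complex_of_real (- \<tau>0 - \<bar>x - r\<bar>)) * q r))"

  \<comment> \<open>The 2N signed roots\<close>
  have R_cases: "\<exists>i<N. R \<sigma> = \<rho> i \<or> R \<sigma> = - \<rho> i" if "\<sigma> < 2 * N" for \<sigma>
    using that by (cases "\<sigma> < N") (auto simp: R_def signed_root_def intro: exI[of _ "\<sigma> - N"])
  have nz: "k j + R \<sigma> \<noteq> 0 \<and> k j - R \<sigma> \<noteq> 0" if "\<sigma> < 2 * N" "j < N" for \<sigma> j
    using R_cases[OF that(1)] assms(11) that(2) unfolding k_def
    by (metis add.inverse_inverse add_eq_0_iff2 right_minus_eq)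
  have R_inj: "inj_on R {..<2 * N}"
  proof (rule inj_onI)
    fix a b assume ab: "a \<in> {..<2 * N}" "b \<in> {..<2 * N}" "R a = R b"
    show "a = b"
    proof (cases "a < N"; cases "b < N")
      assume "a < N" "b < N"
      then show ?thesis using assms(10) ab by (auto simp: R_def signed_root_def)
    next
      assume "a < N" "\<not> b < N"
      then have "b - N < N" "\<rho> a = - \<rho> (b - N)"
        using ab by (auto simp: R_def signed_root_def)
      then show ?thesis using assms(10) \<open>a < N\<close> by blast
    next
      assume "\<not> a < N" "b < N"
      then have "a - N < N" "\<rho> b = - \<rho> (a - N)"
        using ab by (auto simp: R_def signed_root_def)
      then show ?thesis using assms(10) \<open>b < N\<close> by blast
    next
      assume "\<not> a < N" "\<not> b < N"
      then have "a - N < N" "b - N < N" "\<rho> (a - N) = \<rho> (b - N)"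
        using ab by (auto simp: R_def signed_root_def)
      then have "a - N = b - N" using assms(10) by blast
      then show ?thesis using \<open>\<not> a < N\<close> \<open>\<not> b < N\<close> by simp
    qed
  qed
  have root: "(\<Sum>j<N. c j * (2 * k j / ((k j)\<^sup>2 - (R \<sigma>)\<^sup>2))) =
      exp (z * complex_of_real \<tau>0) * (z + complex_of_real \<alpha>)" if \<sigma>: "\<sigma> < 2 * N" for \<sigma>
    unfolding k_def
  proof (rule charP_root)
    show "charP \<tau>0 \<alpha> N c \<mu> z (R \<sigma>) = 0"
      using R_cases[OF \<sigma>] assms(8) by auto
    show "(kf \<mu> z j)\<^sup>2 \<noteq> (R \<sigma>)\<^sup>2" if "j < N" for j
      using nz[OF \<sigma> that] unfolding k_def power2_eq_iff by auto
  qed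

  \<comment> \<open>The weight vector v with T(z) v = (-1, 1)\<close>
  note T = Tmat_carrier[of N \<mu> \<rho> z]
  note minvT = minv_props[OF T assms(12)]
  have mones: "mones N \<in> carrier_vec (2 * N)"
    unfolding mones_def mult_2 by (intro append_carrier_vec) auto
  have v_carrier: "v \<in> carrier_vec (2 * N)"
    unfolding v_def using minvT(1) mones by auto
  have Tv: "Tmat N \<mu> \<rho> z *\<^sub>v v = mones N"
    unfolding v_def assoc_mult_mat_vec[OF T minvT(1) mones, symmetric] minvT(2)
    using mones by simp
  \<comment> \<open>The two block rows of T(z) v = (-1, 1) are the two conditions on v in
    \<open>integral_Jfun_exp\<close>.\<close>
  have v_minus: "(\<Sum>\<sigma><2 * N. v $ \<sigma> / (k j - R \<sigma>)) = -1" if "j < N" for j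
  proof -
    have "(\<Sum>\<sigma><2 * N. v $ \<sigma> / (k j - R \<sigma>)) = (Tmat N \<mu> \<rho> z *\<^sub>v v) $ j"
      using that by (simp add: mult_mat_vec_nth[OF T v_carrier] Tmat_index R_def k_def)
    then show ?thesis unfolding Tv using that by (simp add: mones_def)
  qed
  have v_plus: "(\<Sum>\<sigma><2 * N. v $ \<sigma> / (k j + R \<sigma>)) = 1" if "j < N" for j
  proof -
    have "(\<Sum>\<sigma><2 * N. v $ \<sigma> / (k j + R \<sigma>)) = (Tmat N \<mu> \<rho> z *\<^sub>v v) $ (N + j)"
      using that by (simp add: mult_mat_vec_nth[OF T v_carrier] Tmat_index R_def k_def)
    then show ?thesis unfolding Tv using that by (simp add: mones_def)
  qed

  \<comment> \<open>If z = - alpha, the root equations say that the row vector (c, c) annihilates the invertible T(z).\<close>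
  have za: "z + complex_of_real \<alpha> \<noteq> 0"
  proof
    assume z: "z + complex_of_real \<alpha> = 0"
    define w where "w i = (if i < N then c i else c (i - N))" for i
    have "(\<Sum>i<2 * N. w i * Tmat N \<mu> \<rho> z $$ (i, \<sigma>)) = 0" if \<sigma>: "\<sigma> < 2 * N" for \<sigma>
    proof -
      have "(\<Sum>i<2 * N. w i * Tmat N \<mu> \<rho> z $$ (i, \<sigma>)) =
          (\<Sum>j<N. c j / (k j - R \<sigma>) + c j / (k j + R \<sigma>))"
        unfolding mult_2 sum_lessThan_add sum.distrib using \<sigma>
        by (intro arg_cong2[where f = "(+)"] sum.cong refl) (auto simp: Tmat_index w_def R_def k_def)
      also have "\<dots> = (\<Sum>j<N. c j * (2 * k j / ((k j)\<^sup>2 - (R \<sigma>)\<^sup>2)))"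
      proof (intro sum.cong refl)
        fix j assume "j \<in> {..<N}"
        then have "c j / (k j - R \<sigma>) + c j / (k j + R \<sigma>) =
            (c j * (k j + R \<sigma>) + c j * (k j - R \<sigma>)) / ((k j - R \<sigma>) * (k j + R \<sigma>))"
          using nz[OF \<sigma>] by (intro add_frac_eq) auto
        also have "(k j - R \<sigma>) * (k j + R \<sigma>) = (k j)\<^sup>2 - (R \<sigma>)\<^sup>2"
          by (simp add: power2_eq_square algebra_simps)
        also have "c j * (k j + R \<sigma>) + c j * (k j - R \<sigma>) = c j * (2 * k j)"
          by (simp add: algebra_simps)
        finally show "c j / (k j - R \<sigma>) + c j / (k j + R \<sigma>) = c j * (2 * k j / ((k j)\<^sup>2 - (R \<sigma>)\<^sup>2))"
          by simp
      qed
      finally show ?thesis using root[OF \<sigma>] z by simp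
    qed
    from left_kernel_zero[where w = w and k = 0, OF T assms(12) this]
    have "w 0 = 0" using \<open>N \<ge> 1\<close> by simp
    then show False using assms(3,4) by (simp add: w_def)
  qed

  \<comment> \<open>Invertibility of S(z)\<close>
  note S = Smat_carrier[of N \<mu> \<rho> z]
  \<comment> \<open>Rows j and N + j of S(z) a are the boundary sums, at 1 and at -1, of the
    functions a_\<sigma> exp(R_\<sigma> x).\<close>
  have S_upper: "(Smat N \<mu> \<rho> z *\<^sub>v a) $ j = (\<Sum>\<sigma><2 * N. a $ \<sigma> * exp (R \<sigma>) / (k j - R \<sigma>))"
    and S_lower: "(Smat N \<mu> \<rho> z *\<^sub>v a) $ (N + j) = (\<Sum>\<sigma><2 * N. a $ \<sigma> * exp (- R \<sigma>) / (k j + R \<sigma>))"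
    if "a \<in> carrier_vec (2 * N)" "j < N" for a j
    using that by (simp_all add: mult_mat_vec_nth[OF S] Smat_index R_def k_def mult.commute)

  have S_inv: "invertible_mat (Smat N \<mu> \<rho> z)"
  proof (rule invertible_mat_if_kernel_zero[OF S])
    fix a assume a: "a \<in> carrier_vec (2 * N)" and Sa: "Smat N \<mu> \<rho> z *\<^sub>v a = 0\<^sub>v (2 * N)"
    define E where "E \<sigma> x = a $ \<sigma> * exp (R \<sigma> * complex_of_real x + 0)" for \<sigma> x
    define q where "q x = (\<Sum>\<sigma><2 * N. E \<sigma> x)" for x
    \<comment> \<open>The homogeneous case g = 0; the zero term is kept so that the fact fits
      \<open>integral_Jfun_exp\<close>.\<close>
    have "(E \<sigma> has_vector_derivative R \<sigma> * E \<sigma> x + v $ \<sigma> * 0) (at x within S)" for \<sigma> x S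
      unfolding E_def
      using has_vector_derivative_mult_right[OF exp_of_real_has_vector_derivative[of "R \<sigma>" 0 x S], of "a $ \<sigma>"]
      by (simp add: mult.left_commute)
    note deriv = this
    have bd: "(\<Sum>\<sigma><2 * N. E \<sigma> (-1) / (k j + R \<sigma>)) = 0" "(\<Sum>\<sigma><2 * N. E \<sigma> 1 / (k j - R \<sigma>)) = 0"
      if "j < N" for j
      using S_upper[OF a that] S_lower[OF a that] that unfolding Sa by (simp_all add: E_def)
    have q_eq: "(z + complex_of_real \<alpha>) * q x = ?J q x" if "x \<in> {-1..1}" for x
      using integral_Jfun_exp[where K = "{..<2 * N}" and E = E and R = R and v = "\<lambda>\<sigma>. v $ \<sigma>" and g = "\<lambda>_. 0",
          OF _ that deriv, of N \<mu> z c \<tau>0 \<alpha>] nz v_plus v_minus bd root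
      unfolding k_def q_def by simp
    have q_cont: "continuous_on {-1..1} q"
      unfolding q_def E_def by (intro continuous_intros)
    have 0: "(\<lambda>s x. 0) \<in> Xsp (\<tau>0 + 2)" by (simp add: Xsp_def case_prod_unfold)
    \<comment> \<open>Both sides solve the resolvent equation for \<phi> = 0, so they agree; at
      \<theta> = 0 this says that q vanishes on [-1,1].\<close>
    have "resolvent_ansatz (\<tau>0 + 2) z (\<lambda>s x. 0) q = resolvent_ansatz (\<tau>0 + 2) z (\<lambda>s x. 0) (\<lambda>x. 0)"
    proof (rule resolvent_set_unique[OF assms(6) 0])
      show "genA \<tau>0 \<alpha> N c \<mu> (resolvent_ansatz (\<tau>0 + 2) z (\<lambda>s x. 0) q)
          (\<lambda>s x. z * resolvent_ansatz (\<tau>0 + 2) z (\<lambda>s x. 0) q s x - 0)"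
        using q_eq by (intro genA_resolvent_ansatz assms(1) 0 q_cont) (simp add: hz_def)
      show "genA \<tau>0 \<alpha> N c \<mu> (resolvent_ansatz (\<tau>0 + 2) z (\<lambda>s x. 0) (\<lambda>x. 0))
          (\<lambda>s x. z * resolvent_ansatz (\<tau>0 + 2) z (\<lambda>s x. 0) (\<lambda>x. 0) s x - 0)"
        by (intro genA_resolvent_ansatz assms(1) 0) (simp_all add: hz_def)
    qed auto
    then have at0: "resolvent_ansatz (\<tau>0 + 2) z (\<lambda>s x. 0) q 0 x =
        resolvent_ansatz (\<tau>0 + 2) z (\<lambda>s x. 0) (\<lambda>x. 0) 0 x" for x
      by simp
    have "q x = 0" if "x \<in> {-1..1}" for x
      using at0[of x] that assms(1) by (simp add: resolvent_ansatz_def rect_def Hz_def)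
    then have "\<forall>\<sigma>\<in>{..<2 * N}. a $ \<sigma> = 0"
      by (intro exp_sum_eq_zero_imp_coeff_zero[OF _ R_inj, of "-1" 1]) (simp_all add: q_def E_def)
    then show "a = 0\<^sub>v (2 * N)"
      using a by (intro eq_vecI) auto
  qed
  note minvS = minv_props[OF S S_inv]

  \<comment> \<open>The solution formula\<close>
  have formula: "\<psi> \<theta> x = exp (z * complex_of_real \<theta>) * qz \<tau>0 \<alpha> N c \<mu> \<rho> z \<phi> x0 x + Hz z \<phi> \<theta> x"
    if \<phi>: "\<phi> \<in> Xsp (\<tau>0 + 2)" and gen: "genA \<tau>0 \<alpha> N c \<mu> \<psi> A\<psi>" and res: "(\<lambda>s x. z * \<psi> s x - A\<psi> s x) = \<phi>"
      and x0: "x0 \<in> {-1..1}" and \<theta>: "\<theta> \<in> {-(\<tau>0 + 2)..0}" and x: "x \<in> {-1..1}"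
    for \<phi> \<psi> A\<psi> x0 \<theta> x
  proof -
    define g where "g r = hz \<tau>0 N c \<mu> z \<phi> r / (z + complex_of_real \<alpha>)" for r
    define \<Gamma>h where "\<Gamma>h = Gammahat \<tau>0 \<alpha> N c \<mu> \<rho> z \<phi> x0"
    define \<Gamma>0 where "\<Gamma>0 = Gamma0 \<tau>0 \<alpha> N c \<mu> \<rho> z \<phi> x0"
    define E where "E \<sigma> x = (\<Gamma>0 + \<Gamma>h x) $ \<sigma> * exp (R \<sigma> * complex_of_real x + 0)" for \<sigma> x
    define q where "q = (\<lambda>x. g x + (\<Sum>\<sigma><2 * N. E \<sigma> x))"
    have \<Gamma>h_carrier: "\<Gamma>h y \<in> carrier_vec (2 * N)" for y
      by (simp add: \<Gamma>h_def Gammahat_def)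
    define m where "m = Smid N \<mu> \<rho> z *\<^sub>v (\<Gamma>h 1 @\<^sub>v \<Gamma>h (-1))"
    have m_carrier: "m \<in> carrier_vec (2 * N)"
      unfolding m_def using Smid_carrier[of N \<mu> \<rho> z] by (intro carrier_vecI) simp
    have \<Gamma>0_eq: "\<Gamma>0 = - (minv (Smat N \<mu> \<rho> z) *\<^sub>v m)"
      by (simp add: \<Gamma>0_def Gamma0_def m_def \<Gamma>h_def)
    then have \<Gamma>0_carrier: "\<Gamma>0 \<in> carrier_vec (2 * N)"
      using minvS(1) m_carrier by auto
    have "Smat N \<mu> \<rho> z *\<^sub>v \<Gamma>0 = - (Smat N \<mu> \<rho> z *\<^sub>v (minv (Smat N \<mu> \<rho> z) *\<^sub>v m))"
      unfolding \<Gamma>0_eq using S minvS(1) m_carrier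
      by (intro eq_vecI) auto
    also have "\<dots> = - m"
      unfolding assoc_mult_mat_vec[OF S minvS(1) m_carrier, symmetric] minvS(2) using m_carrier by simp
    finally have S\<Gamma>0: "Smat N \<mu> \<rho> z *\<^sub>v \<Gamma>0 = - m" .
    \<comment> \<open>For i < N, \<open>m\<close> has the entry belonging to y = 1, for the other i
      the one belonging to y = -1. At the matching y the difference is therefore zero, which gives
      the two boundary conditions.\<close>
    have S\<Gamma>: "(Smat N \<mu> \<rho> z *\<^sub>v (\<Gamma>0 + \<Gamma>h y)) $ i = (Smat N \<mu> \<rho> z *\<^sub>v \<Gamma>h y) $ i - m $ i"
      if "i < 2 * N" for i y
      unfolding mult_add_distrib_mat_vec[OF S \<Gamma>0_carrier \<Gamma>h_carrier] S\<Gamma>0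
      using that m_carrier S by simp
    have bd_right: "(\<Sum>\<sigma><2 * N. E \<sigma> 1 / (k j - R \<sigma>)) = 0" if "j < N" for j
    proof -
      have "(\<Sum>\<sigma><2 * N. E \<sigma> 1 / (k j - R \<sigma>)) = (Smat N \<mu> \<rho> z *\<^sub>v (\<Gamma>0 + \<Gamma>h 1)) $ j"
        unfolding S_upper[OF add_carrier_vec[OF \<Gamma>0_carrier \<Gamma>h_carrier] that] by (simp add: E_def)
      also have "\<dots> = 0"
        using that S\<Gamma>[of j 1] by (simp add: m_def Smid_mult_append[OF \<Gamma>h_carrier \<Gamma>h_carrier])
      finally show ?thesis .
    qed
    have bd_left: "(\<Sum>\<sigma><2 * N. E \<sigma> (-1) / (k j + R \<sigma>)) = 0" if "j < N" for j
    proof -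
      have "(\<Sum>\<sigma><2 * N. E \<sigma> (-1) / (k j + R \<sigma>)) = (Smat N \<mu> \<rho> z *\<^sub>v (\<Gamma>0 + \<Gamma>h (-1))) $ (N + j)"
        unfolding S_lower[OF add_carrier_vec[OF \<Gamma>0_carrier \<Gamma>h_carrier] that] by (simp add: E_def)
      also have "\<dots> = 0"
        using that S\<Gamma>[of "N + j" "-1"] by (simp add: m_def Smid_mult_append[OF \<Gamma>h_carrier \<Gamma>h_carrier])
      finally show ?thesis .
    qed
    have g_cont: "continuous_on {-1..1} g"
      unfolding g_def using \<phi> za
      by (intro continuous_intros continuous_on_hz assms(1)) (auto simp: Xsp_def)
    have \<Gamma>h_nth: "\<Gamma>h y $ \<sigma> = oint x0 y (\<lambda>r. g r * (exp (- R \<sigma> * complex_of_real r + 0) * v $ \<sigma>))"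
      if "\<sigma> < 2 * N" for \<sigma> y
      using that unfolding \<Gamma>h_def Gammahat_def v_def[symmetric] g_def[symmetric]
      by (simp add: Pblock_mult[OF v_carrier] R_def)
    \<comment> \<open>Differentiating the coefficient produces g v times exp(-R y), which the
      exponential in E cancels; differentiating that exponential gives R E.\<close>
    have deriv: "(E \<sigma> has_vector_derivative R \<sigma> * E \<sigma> y + v $ \<sigma> * g y) (at y within {-1..1})"
      if \<sigma>: "\<sigma> \<in> {..<2 * N}" and y: "y \<in> {-1..1}" for \<sigma> y
    proof -
      let ?w = "\<lambda>r. g r * (exp (- R \<sigma> * complex_of_real r + 0) * v $ \<sigma>)"
      have "((\<lambda>y. \<Gamma>0 $ \<sigma> + oint x0 y ?w) has_vector_derivative 0 + ?w y) (at y within {-1..1})"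
        by (intro has_vector_derivative_add has_vector_derivative_const oint_has_vector_derivative
            continuous_intros g_cont x0 y)
      from has_vector_derivative_mult[OF this exp_of_real_has_vector_derivative[of "R \<sigma>" 0]]
      have "(E \<sigma> has_vector_derivative (\<Gamma>0 $ \<sigma> + oint x0 y ?w) * (R \<sigma> * exp (R \<sigma> * complex_of_real y + 0)) +
          (0 + ?w y) * exp (R \<sigma> * complex_of_real y + 0)) (at y within {-1..1})"
        unfolding E_def[abs_def] using \<sigma> carrier_vecD[OF \<Gamma>h_carrier] by (simp add: \<Gamma>h_nth)
      moreover have "(0 + ?w y) * exp (R \<sigma> * complex_of_real y + 0) = v $ \<sigma> * g y"
        by (simp add: exp_minus)
      moreover have "(\<Gamma>0 $ \<sigma> + oint x0 y ?w) * (R \<sigma> * exp (R \<sigma> * complex_of_real y + 0)) = R \<sigma> * E \<sigma> y"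
        unfolding E_def using \<sigma> carrier_vecD[OF \<Gamma>h_carrier] by (simp add: \<Gamma>h_nth)
      ultimately show ?thesis by (simp only:)
    qed
    have q_cont: "continuous_on {-1..1} q"
      unfolding q_def
      by (intro continuous_intros g_cont continuous_on_vector_derivative[OF deriv])
    \<comment> \<open>\<open>integral_Jfun_exp\<close> accounts for the sum of the E, and (z +
      \<alpha>) g = \<open>hz\<close> because \<open>za\<close> permits the division in g.\<close>
    have "(z + complex_of_real \<alpha>) * q y = hz \<tau>0 N c \<mu> z \<phi> y + ?J q y" if "y \<in> {-1..1}" for y
      using integral_Jfun_exp[where K = "{..<2 * N}" and E = E and R = R and v = "\<lambda>\<sigma>. v $ \<sigma>" and g = g,
          OF _ that deriv, of N \<mu> z c \<tau>0 \<alpha>] nz v_plus v_minus bd_left bd_right root za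
      unfolding k_def q_def by (simp add: distrib_left g_def)
    from genA_resolvent_ansatz[OF assms(1) \<phi> q_cont this]
    have "\<psi> = resolvent_ansatz (\<tau>0 + 2) z \<phi> q"
      by (intro resolvent_set_unique[OF assms(6) \<phi> gen res]) auto
    \<comment> \<open>The sum over 2N signed roots splits into the halves belonging to \<rho> i and
      - \<rho> i, as in \<open>qz\<close>.\<close>
    moreover have "q x = qz \<tau>0 \<alpha> N c \<mu> \<rho> z \<phi> x0 x"
      unfolding q_def qz_def g_def Gammaz_def mult_2 sum_lessThan_add sum.distrib
      by (simp add: E_def \<Gamma>0_def[symmetric] \<Gamma>h_def[symmetric] R_def signed_root_def)
    ultimately show ?thesis
      using \<theta> x by (simp add: resolvent_ansatz_def rect_def)
  qed
  show ?thesis using S_inv formula by blast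
qed

end
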